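(* Let $f(u,v)>0$, $\nu(u,v)$, $\lambda_1(u,v)$, $\mu_1(u,v)$, $\lambda_2(u,v)$, $\mu_2(u,v)$, $\mu_1\mu_2\neq 0$, be six smooth functions, defined in a domain $\mathcal{D}\subset\mathbb{R}^2$, and satisfying the conditions (i) $(\lambda_2^2+\mu_2^2)_u+(\ln f^4)_u(\lambda_2^2+\mu_2^2)+2\lambda_2\nu_v+\frac{2\nu\mu_2}{\mu_1}\bigl(\nu_u+(\lambda_1)_v+\lambda_1(\ln f^2)_v\bigr)=0$; (ii) $(\lambda_1^2+\mu_1^2)_v+(\ln f^4)_v(\lambda_1^2+\mu_1^2)+2\lambda_1\nu_u+\frac{2\nu\mu_1}{\mu_2}\bigl((\lambda_2)_u+\nu_v+\lambda_2(\ln f^2)_u\bigr)=0$; (iii) $\frac{2ff_{uv}-2f_uf_v}{f^4}+\lambda_1\lambda_2+\mu_1\mu_2-\nu^2=0$; (iv) $(\mu_1\lambda_2-\mu_2\lambda_1)\bigl(f^2\mu_1\mu_2-(\ln f^2)_{uv}\bigr)+\nu_{uu}\mu_2-\nu_{vv}\mu_1+(\lambda_1)_{uv}\mu_2-(\lambda_2)_{uv}\mu_1+\mu_2(\lambda_1)_u(\ln f^2)_v-\mu_1(\lambda_2)_v(\ln f^2)_u-\frac{\mu_2(\mu_1)_u}{\mu_1}\bigl(\nu_u+(\lambda_1)_v+\lambda_1(\ln f^2)_v\bigr)+\frac{\mu_1(\mu_2)_v}{\mu_2}\bigl((\lambda_2)_u+\nu_v+\lambda_2(\ln f^2)_u\bigr)=0$.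 If $\{x_0,y_0,(n_1)_0,(n_2)_0\}$ is a pseudo-orthonormal frame at a point $p_0\in\mathbb{R}^4_1$, then there exists a subdomain $\mathcal{D}_0\subset\mathcal{D}$ and a unique timelike surface of first type $\mathcal{M}^2: z=z(u,v)$, $(u,v)\in\mathcal{D}_0$, parametrized by isotropic parameters, such that $\mathcal{M}^2$ passes through $p_0$ and $\{x_0,y_0,(n_1)_0,(n_2)_0\}$ is the geometric frame of $\mathcal{M}^2$ at $p_0$.
   Context: $\mathbb{R}^4_1$ is the four-dimensional Minkowski space with the flat metric $\langle\cdot,\cdot\rangle=dx_1^2+dx_2^2+dx_3^2-dx_4^2$. All considerations are local and all functions are $C^\infty$; subscripts $u,v$ on functions denote partial derivatives (e.g. $(\lambda_1)_u=\partial\lambda_1/\partial u$). A pseudo-orthonormal frame is a basis $\{x,y,n_1,n_2\}$ of $\mathbb{R}^4_1$ with $\langle x,x\rangle=\langle y,y\rangle=0$, $\langle x,y\rangle=-1$, $\langle n_1,n_1\rangle=\langle n_2,n_2\rangle=1$, and $\langle n_1,n_2\rangle=\langle x,n_i\rangle=\langle y,n_i\rangle=0$ for $i=1,2$. A surface $\mathcal{M}^2: z=z(u,v)$ in $\mathbb{R}^4_1$ is an immersion of a domain of $\mathbb{R}^2$; it is timelike if the restriction of $\langle\cdot,\cdot\rangle$ to each tangent space is indefinite. The parameters $(u,v)$ are isotropic if $\langle z_u,z_u\rangle=0$, $\langle z_v,z_v\rangle=0$, $\langle z_u,z_v\rangle=-f^2(u,v)$ for a positive function $f$. Let $\sigma$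 be the second fundamental tensor and $H=\frac12\operatorname{tr}\sigma$ the mean curvature vector field. Only surfaces free of minimal points ($H\neq0$ at all points) are considered. Geometric frame field: for such a timelike surface in isotropic parameters put $x=z_u/f$, $y=z_v/f$, so that $H=-\sigma(x,y)$; let $n_1$ be the unit normal vector field collinear with $H$, $H=\nu n_1$, $\nu=\|H\|$; let $n_2$ be a unit normal vector field such that $\{n_1,n_2\}$ is an orthonormal frame field of the normal bundle ($n_2$ is determined up to sign). Then $\{x,y,n_1,n_2\}$ is called the geometric frame field of the surface, and one has $\sigma(x,x)=\lambda_1n_1+\mu_1n_2$, $\sigma(x,y)=-\nu n_1$, $\sigma(y,y)=\lambda_2n_1+\mu_2n_2$ with smooth functions $\lambda_1,\mu_1,\lambda_2,\mu_2$ of the surface. A timelike surface is of first type if $\mu_1\neq0$ and $\mu_2\neq0$.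
   Formalization: The function ν is additionally assumed positive on the domain (otherwise no surface with ν=‖H‖, H≠0 exists), and the surface is explicitly required to have f, ν, λ1, μ1, λ2, μ2 as the functions of its geometric frame field. *)

theory Defs
  imports "HOL-Analysis.Analysis"
begin

definition domain2 :: "(real \<times> real) set \<Rightarrow> bool" where
  "domain2 D \<longleftrightarrow> open D \<and> connected D \<and> D \<noteq> {}"

definition pd_u :: "(real \<times> real \<Rightarrow> 'a::real_normed_vector) \<Rightarrow> real \<times> real \<Rightarrow> 'a" where
  "pd_u g p = vector_derivative (\<lambda>s. g (s, snd p)) (at (fst p))"

definition pd_v :: "(real \<times> real \<Rightarrow> 'a::real_normed_vector) \<Rightarrow> real \<times> real \<Rightarrow> 'a" where
  "pd_v g p = vector_derivative (\<lambda>t. g (fst p, t)) (at (snd p))"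

(* Both notions below are meant for open S. *)

fun Ck_on :: "nat \<Rightarrow> (real \<times> real) set \<Rightarrow> (real \<times> real \<Rightarrow> 'a::real_normed_vector) \<Rightarrow> bool" where
  "Ck_on 0 S g \<longleftrightarrow> continuous_on S g"
| "Ck_on (Suc k) S g \<longleftrightarrow>
     (\<forall>p\<in>S. g differentiable (at p)) \<and>
     (\<forall>h. Ck_on k S (\<lambda>p. frechet_derivative g (at p) h))"

definition smooth2_on :: "(real \<times> real) set \<Rightarrow> (real \<times> real \<Rightarrow> 'a::real_normed_vector) \<Rightarrow> bool" where
  "smooth2_on S g \<longleftrightarrow> (\<forall>k. Ck_on k S g)"


definition mink :: "real ^ 4 \<Rightarrow> real ^ 4 \<Rightarrow> real" where
  "mink a b = a $ 1 * b $ 1 + a $ 2 * b $ 2 + a $ 3 * b $ 3 - a $ 4 * b $ 4"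

definition pseudo_orthonormal_frame ::
    "real ^ 4 \<Rightarrow> real ^ 4 \<Rightarrow> real ^ 4 \<Rightarrow> real ^ 4 \<Rightarrow> bool" where
  "pseudo_orthonormal_frame x y n1 n2 \<longleftrightarrow>
     independent {x, y, n1, n2} \<and> span {x, y, n1, n2} = UNIV \<and>
     mink x x = 0 \<and> mink y y = 0 \<and> mink x y = - 1 \<and>
     mink n1 n1 = 1 \<and> mink n2 n2 = 1 \<and> mink n1 n2 = 0 \<and>
     mink x n1 = 0 \<and> mink x n2 = 0 \<and> mink y n1 = 0 \<and> mink y n2 = 0"


type_synonym surface = "real \<times> real \<Rightarrow> real ^ 4"

definition tangent_plane :: "surface \<Rightarrow> real \<times> real \<Rightarrow> (real ^ 4) set" where
  "tangent_plane z p = span {pd_u z p, pd_v z p}"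

definition normal_plane :: "surface \<Rightarrow> real \<times> real \<Rightarrow> (real ^ 4) set" where
  "normal_plane z p = {w. \<forall>t\<in>tangent_plane z p. mink w t = 0}"

definition immersed_surface :: "(real \<times> real) set \<Rightarrow> surface \<Rightarrow> bool" where
  "immersed_surface U z \<longleftrightarrow> domain2 U \<and> smooth2_on U z \<and>
     (\<forall>p\<in>U. pd_u z p \<noteq> pd_v z p \<and> independent {pd_u z p, pd_v z p})"

definition timelike_surface :: "(real \<times> real) set \<Rightarrow> surface \<Rightarrow> bool" where
  "timelike_surface U z \<longleftrightarrow> immersed_surface U z \<and>
     (\<forall>p\<in>U. (\<exists>t\<in>tangent_plane z p. mink t t > 0) \<and> (\<exists>t\<in>tangent_plane z p. mink t t < 0))"

definition isotropic_parameters ::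
    "(real \<times> real) set \<Rightarrow> (real \<times> real \<Rightarrow> real) \<Rightarrow> surface \<Rightarrow> bool" where
  "isotropic_parameters U f z \<longleftrightarrow>
     (\<forall>p\<in>U. f p > 0 \<and> mink (pd_u z p) (pd_u z p) = 0 \<and> mink (pd_v z p) (pd_v z p) = 0 \<and>
            mink (pd_u z p) (pd_v z p) = - (f p)\<^sup>2)"

(* The normal component and the tangential coordinates are well defined where the tangent
   plane is two-dimensional and the induced metric on it is nondegenerate. *)

definition normal_part :: "surface \<Rightarrow> real \<times> real \<Rightarrow> real ^ 4 \<Rightarrow> real ^ 4" where
  "normal_part z p w = (THE n. n \<in> normal_plane z p \<and> w - n \<in> tangent_plane z p)"

definition tangent_coords :: "surface \<Rightarrow> real \<times> real \<Rightarrow> real ^ 4 \<Rightarrow> real \<times> real" where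
  "tangent_coords z p X = (THE c. X = fst c *\<^sub>R pd_u z p + snd c *\<^sub>R pd_v z p)"

(* sigma(X, Y) is the normal component of the flat derivative D_X Y, where the tangent vector Y
   is extended with constant coefficients with respect to z_u, z_v. *)
definition second_fundamental :: "surface \<Rightarrow> real \<times> real \<Rightarrow> real ^ 4 \<Rightarrow> real ^ 4 \<Rightarrow> real ^ 4" where
  "second_fundamental z p X Y =
     (let (a, b) = tangent_coords z p X; (c, d) = tangent_coords z p Y
      in normal_part z p
           (a *\<^sub>R (c *\<^sub>R pd_u (pd_u z) p + d *\<^sub>R pd_u (pd_v z) p) +
            b *\<^sub>R (c *\<^sub>R pd_v (pd_u z) p + d *\<^sub>R pd_v (pd_v z) p)))"

(* H = 1/2 tr sigma, the trace being g^{ij} sigma_{ij} with g^{ij} the inverse of the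
   induced metric E du^2 + 2 F du dv + G dv^2. *)
definition mean_curvature_vector :: "surface \<Rightarrow> real \<times> real \<Rightarrow> real ^ 4" where
  "mean_curvature_vector z p =
     (let zu = pd_u z p; zv = pd_v z p;
          E = mink zu zu; F = mink zu zv; G = mink zv zv
      in (1 / 2) *\<^sub>R (1 / (E * G - F\<^sup>2)) *\<^sub>R
           (G *\<^sub>R second_fundamental z p zu zu
            - F *\<^sub>R second_fundamental z p zu zv - F *\<^sub>R second_fundamental z p zv zu
            + E *\<^sub>R second_fundamental z p zv zv))"

definition free_of_minimal_points :: "(real \<times> real) set \<Rightarrow> surface \<Rightarrow> bool" where
  "free_of_minimal_points U z \<longleftrightarrow> (\<forall>p\<in>U. mean_curvature_vector z p \<noteq> 0)"

(* The normal planes of a timelike surface are spacelike, so mink H H is nonnegative. *)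
definition mean_curvature :: "surface \<Rightarrow> real \<times> real \<Rightarrow> real" where
  "mean_curvature z p = sqrt (mink (mean_curvature_vector z p) (mean_curvature_vector z p))"

(* A relation rather than a function of z, because n2 is only determined up to sign. *)
definition geometric_frame_field ::
    "(real \<times> real) set \<Rightarrow> (real \<times> real \<Rightarrow> real) \<Rightarrow> surface \<Rightarrow>
     surface \<Rightarrow> surface \<Rightarrow> surface \<Rightarrow> surface \<Rightarrow> bool" where
  "geometric_frame_field U f z x y n1 n2 \<longleftrightarrow>
     smooth2_on U n1 \<and> smooth2_on U n2 \<and>
     (\<forall>p\<in>U. x p = (1 / f p) *\<^sub>R pd_u z p \<and> y p = (1 / f p) *\<^sub>R pd_v z p \<and>
        n1 p \<in> normal_plane z p \<and> mink (n1 p) (n1 p) = 1 \<and>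
        mean_curvature_vector z p = mean_curvature z p *\<^sub>R n1 p \<and>
        n2 p \<in> normal_plane z p \<and> mink (n2 p) (n2 p) = 1 \<and> mink (n1 p) (n2 p) = 0)"

definition geometric_functions ::
    "(real \<times> real) set \<Rightarrow> surface \<Rightarrow> surface \<Rightarrow> surface \<Rightarrow> surface \<Rightarrow> surface \<Rightarrow>
     (real \<times> real \<Rightarrow> real) \<Rightarrow> (real \<times> real \<Rightarrow> real) \<Rightarrow> (real \<times> real \<Rightarrow> real) \<Rightarrow>
     (real \<times> real \<Rightarrow> real) \<Rightarrow> (real \<times> real \<Rightarrow> real) \<Rightarrow> bool" where
  "geometric_functions U z x y n1 n2 \<nu> lam1 \<mu>1 lam2 \<mu>2 \<longleftrightarrow>
     (\<forall>p\<in>U. mean_curvature z p = \<nu> p \<and>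
        second_fundamental z p (x p) (x p) = lam1 p *\<^sub>R n1 p + \<mu>1 p *\<^sub>R n2 p \<and>
        second_fundamental z p (x p) (y p) = - (\<nu> p *\<^sub>R n1 p) \<and>
        second_fundamental z p (y p) (y p) = lam2 p *\<^sub>R n1 p + \<mu>2 p *\<^sub>R n2 p)"

(* Changing the sign of n2 changes the signs of mu1 and mu2, so the condition does not depend
   on the choice of the geometric frame field. *)
definition first_type_surface :: "(real \<times> real) set \<Rightarrow> (real \<times> real \<Rightarrow> real) \<Rightarrow> surface \<Rightarrow> bool" where
  "first_type_surface U f z \<longleftrightarrow>
     timelike_surface U z \<and> isotropic_parameters U f z \<and> free_of_minimal_points U z \<and>
     (\<exists>x y n1 n2 \<nu> lam1 \<mu>1 lam2 \<mu>2.
        geometric_frame_field U f z x y n1 n2 \<and>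
        geometric_functions U z x y n1 n2 \<nu> lam1 \<mu>1 lam2 \<mu>2 \<and>
        (\<forall>p\<in>U. \<mu>1 p \<noteq> 0 \<and> \<mu>2 p \<noteq> 0))"

(* The surface realizes the prescribed functions and has the prescribed geometric frame
   (x0, y0, n10, n20) at the point p0 with parameters q0. *)
definition realizes ::
    "(real \<times> real) set \<Rightarrow> (real \<times> real \<Rightarrow> real) \<Rightarrow> (real \<times> real \<Rightarrow> real) \<Rightarrow>
     (real \<times> real \<Rightarrow> real) \<Rightarrow> (real \<times> real \<Rightarrow> real) \<Rightarrow> (real \<times> real \<Rightarrow> real) \<Rightarrow>
     (real \<times> real \<Rightarrow> real) \<Rightarrow> real \<times> real \<Rightarrow> real ^ 4 \<Rightarrow>
     real ^ 4 \<Rightarrow> real ^ 4 \<Rightarrow> real ^ 4 \<Rightarrow> real ^ 4 \<Rightarrow> surface \<Rightarrow> bool" where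
  "realizes U f \<nu> lam1 \<mu>1 lam2 \<mu>2 q0 p0 x0 y0 n10 n20 z \<longleftrightarrow>
     z q0 = p0 \<and>
     (\<exists>x y n1 n2. geometric_frame_field U f z x y n1 n2 \<and>
        geometric_functions U z x y n1 n2 \<nu> lam1 \<mu>1 lam2 \<mu>2 \<and>
        x q0 = x0 \<and> y q0 = y0 \<and> n1 q0 = n10 \<and> n2 q0 = n20)"

end

(* The vectors z, x, y, n1, n2 satisfy a linear system X_u = A X, X_v = B X whose coefficients are
   f, f_u/f, f_v/f, f lam_i, f mu_i, f nu and two further functions b1, b2 (f times the components of
   the normal connection), which the Codazzi equations express through the prescribed data.
   Conditions (i)-(iv) are exactly the integrability condition A_v + A B = B_u + B A: (i) and (ii) are
   the remaining Codazzi equations, (iii) is the Gauss and (iv) the Ricci equation. So the system has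
   a unique smooth solution near q0 with prescribed initial value. The inner products of the frame
   vectors are preserved by the system, hence the z-component is a surface with the prescribed data;
   conversely the geometric frame of any such surface solves the same system. *)

theory Submission
  imports Defs
begin

subsection \<open>Calculus of smooth functions of two variables\<close>

text \<open>The \<open>n1\<close>-components of the Codazzi equations give only the products
  \<open>\<mu>2 * b1\<close> and \<open>\<mu>1 * b2\<close>. Division by \<open>\<mu>1\<close> and
  \<open>\<mu>2\<close> makes the normal connection a function of the data, so that the linear
  system is closed. Positivity of \<nu> makes it the length of the mean curvature vector and not
  merely a coefficient, and excludes minimal points. The obstacle in the linear system is that one
  unknown obeys two equations. Integrating in v along the line u = u0 and then in u gives a function
  for which the equation in v is known on that line only. Off the line, integrability cancels all
  terms of the error except those containing the error itself, and on a small square these force it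
  to vanish. The square depends on the coefficients and not on the initial value, so one subdomain
  serves for existence and for uniqueness against every competing surface on it. For such a
  competitor the normal connection is a priori unknown; equality of the mixed second derivatives of
  x and of y identifies it with \<open>b1\<close> and \<open>b2\<close>.\<close>

lemma Ck_on_cong:
  assumes "open S" "\<And>p. p \<in> S \<Longrightarrow> f p = g p"
  shows "Ck_on k S f = Ck_on k S g"
  using assms(2)
proof (induction k arbitrary: f g)
  case 0
  then show ?case by (auto intro: continuous_on_cong)
next
  case (Suc k)
  have *: "(f has_derivative f') (at p) \<longleftrightarrow> (g has_derivative f') (at p)" if "p \<in> S" for f' p
    using Suc.prems that assms(1)
    by (metis has_derivative_transform_within_open)
  then have "frechet_derivative f (at p) = frechet_derivative g (at p)" if "p \<in> S" for p
    using that by (simp add: frechet_derivative_def)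
  then have "Ck_on k S (\<lambda>p. frechet_derivative f (at p) h) = Ck_on k S (\<lambda>p. frechet_derivative g (at p) h)" for h
    by (intro Suc.IH) simp
  with * show ?case by (auto simp: differentiable_def)
qed

lemma Ck_on_subset: "Ck_on k S f \<Longrightarrow> T \<subseteq> S \<Longrightarrow> Ck_on k T f"
  by (induction k arbitrary: f) (auto intro: continuous_on_subset)

text \<open>Derivatives on an open set are unique, so an explicit formula \<open>g'\<close> may
  stand in for \<open>frechet_derivative\<close>. The closure rules below run their inductions on
  such formulas.\<close>

lemma Ck_on_SucI:
  assumes "open S" "\<And>p. p \<in> S \<Longrightarrow> (g has_derivative g' p) (at p)"
    "\<And>h. Ck_on k S (\<lambda>p. g' p h)"
  shows "Ck_on (Suc k) S g"
proof -
  have "frechet_derivative g (at p) = g' p" if "p \<in> S" for p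
    using frechet_derivative_at[OF assms(2)[OF that]] by simp
  then have "Ck_on k S (\<lambda>p. frechet_derivative g (at p) h) = Ck_on k S (\<lambda>p. g' p h)" for h
    by (intro Ck_on_cong[OF assms(1)]) simp
  with assms(3) have "Ck_on k S (\<lambda>p. frechet_derivative g (at p) h)" for h
    by simp
  with assms(2) show ?thesis by (auto simp: differentiable_def)
qed

lemma Ck_on_frechet_derivative:
  "Ck_on (Suc k) S g \<Longrightarrow> Ck_on k S (\<lambda>p. frechet_derivative g (at p) h)"
  by (simp only: Ck_on.simps)

text \<open>By definition the class \<open>Suc k\<close> constrains the derivative of
  \<open>g\<close> only. The product rule keeps one factor undifferentiated, so its induction needs
  this descent for the factors themselves.\<close>

lemma Ck_on_SucD: "Ck_on (Suc k) S g \<Longrightarrow> Ck_on k S g"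
proof (induction k arbitrary: g)
  case 0
  then show ?case
    by (simp add: continuous_at_imp_continuous_on differentiable_imp_continuous_within)
next
  case (Suc k)
  have "Ck_on k S (\<lambda>p. frechet_derivative g (at p) h)" for h
    by (intro Suc.IH Ck_on_frechet_derivative Suc.prems)
  with Suc.prems show ?case by simp
qed

lemma Ck_on_has_derivative:
  "Ck_on (Suc k) S g \<Longrightarrow> p \<in> S \<Longrightarrow> (g has_derivative frechet_derivative g (at p)) (at p)"
  by (simp add: frechet_derivative_works)

lemma Ck_on_const: "open S \<Longrightarrow> Ck_on k S (\<lambda>p. c)"
proof (induction k arbitrary: c)
  case (Suc k)
  then show ?case by (intro Ck_on_SucI[where g' = "\<lambda>_ _. 0"]) auto
qed simp

lemma Ck_on_add:
  assumes "open S"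
  shows "Ck_on k S f \<Longrightarrow> Ck_on k S g \<Longrightarrow> Ck_on k S (\<lambda>p. f p + g p)"
proof (induction k arbitrary: f g)
  case (Suc k)
  then show ?case
    by (intro Ck_on_SucI[OF assms has_derivative_add[OF Ck_on_has_derivative Ck_on_has_derivative]])
      auto
qed (auto intro: continuous_intros)

lemma (in bounded_bilinear) Ck_on:
  assumes "open S"
  shows "Ck_on k S f \<Longrightarrow> Ck_on k S g \<Longrightarrow> Ck_on k S (\<lambda>p. prod (f p) (g p))"
proof (induction k arbitrary: f g)
  case (Suc k)
  note f = Ck_on_SucD[OF Suc.prems(1)] Ck_on_frechet_derivative[OF Suc.prems(1)]
  note g = Ck_on_SucD[OF Suc.prems(2)] Ck_on_frechet_derivative[OF Suc.prems(2)]
  show ?case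
    by (rule Ck_on_SucI[OF assms FDERIV[OF Ck_on_has_derivative[OF Suc.prems(1)]
            Ck_on_has_derivative[OF Suc.prems(2)]]], assumption, assumption)
      (rule Ck_on_add[OF assms Suc.IH[OF f(1) g(2)] Suc.IH[OF f(2) g(1)]])
qed (auto intro: continuous_on)

lemma (in bounded_linear) Ck_on:
  assumes "open S"
  shows "Ck_on k S g \<Longrightarrow> Ck_on k S (\<lambda>p. f (g p))"
proof (induction k arbitrary: g)
  case (Suc k)
  then show ?case
    by (intro Ck_on_SucI[OF assms has_derivative[OF Ck_on_has_derivative]]) auto
qed (auto intro: continuous_on)

lemma Ck_on_inverse:
  fixes f :: "real \<times> real \<Rightarrow> real"
  assumes "open S" "\<And>p. p \<in> S \<Longrightarrow> f p \<noteq> 0"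
  shows "Ck_on k S f \<Longrightarrow> Ck_on k S (\<lambda>p. inverse (f p))"
proof (induction k)
  case 0
  with assms show ?case by (auto intro!: continuous_intros)
next
  case (Suc k)
  \<comment> \<open>The derivative of \<open>1 / f\<close> is built from that of \<open>f\<close>
    and two copies of \<open>1 / f\<close>, to which the induction hypothesis applies.\<close>
  have "Ck_on k S (\<lambda>p. (- 1) * (inverse (f p) * frechet_derivative f (at p) h * inverse (f p)))" for h
    using Ck_on_SucD[OF Suc.prems] Ck_on_frechet_derivative[OF Suc.prems]
    by (intro bounded_bilinear.Ck_on[OF bounded_bilinear_mult assms(1)] Ck_on_const assms Suc.IH)
  then show ?case
    by (intro Ck_on_SucI[OF assms(1) Deriv.has_derivative_inverse[OF _ Ck_on_has_derivative]])
      (use Suc.prems assms(2) in auto)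
qed

lemma smooth2_on_cong:
  "open S \<Longrightarrow> (\<And>p. p \<in> S \<Longrightarrow> f p = g p) \<Longrightarrow> smooth2_on S f = smooth2_on S g"
  unfolding smooth2_on_def using Ck_on_cong by blast

lemma smooth2_on_subset: "smooth2_on S f \<Longrightarrow> T \<subseteq> S \<Longrightarrow> smooth2_on T f"
  by (auto simp: smooth2_on_def intro: Ck_on_subset)

lemma smooth2_on_const: "open S \<Longrightarrow> smooth2_on S (\<lambda>p. c)"
  by (simp add: smooth2_on_def Ck_on_const)

lemma smooth2_on_add:
  "open S \<Longrightarrow> smooth2_on S f \<Longrightarrow> smooth2_on S g \<Longrightarrow> smooth2_on S (\<lambda>p. f p + g p)"
  by (simp add: smooth2_on_def Ck_on_add)

lemma (in bounded_linear) smooth2_on: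
  "open S \<Longrightarrow> smooth2_on S g \<Longrightarrow> smooth2_on S (\<lambda>p. f (g p))"
  by (simp add: smooth2_on_def Ck_on)

lemma (in bounded_bilinear) smooth2_on:
  "open S \<Longrightarrow> smooth2_on S f \<Longrightarrow> smooth2_on S g \<Longrightarrow> smooth2_on S (\<lambda>p. prod (f p) (g p))"
  by (simp add: smooth2_on_def Ck_on)

lemmas smooth2_on_mult = bounded_bilinear.smooth2_on[OF bounded_bilinear_mult]
lemmas smooth2_on_scaleR = bounded_bilinear.smooth2_on[OF bounded_bilinear_scaleR]

lemma smooth2_on_divide:
  fixes f g :: "real \<times> real \<Rightarrow> real"
  shows "open S \<Longrightarrow> smooth2_on S f \<Longrightarrow> smooth2_on S g \<Longrightarrow> (\<And>p. p \<in> S \<Longrightarrow> g p \<noteq> 0) \<Longrightarrow>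
    smooth2_on S (\<lambda>p. f p / g p)"
  unfolding divide_inverse
  by (intro smooth2_on_mult) (simp_all add: smooth2_on_def Ck_on_inverse)

lemma smooth2_on_differentiable: "smooth2_on S g \<Longrightarrow> p \<in> S \<Longrightarrow> g differentiable (at p)"
  unfolding smooth2_on_def by (metis Ck_on.simps(2))

lemma smooth2_on_continuous_on: "smooth2_on S g \<Longrightarrow> continuous_on S g"
  unfolding smooth2_on_def by (metis Ck_on.simps(1))

section \<open>Partial derivatives and their rules\<close>

lemma has_derivative_imp_pd:
  assumes "(g has_derivative g') (at p)"
  shows "((\<lambda>s. g (s, snd p)) has_vector_derivative g' (1, 0)) (at (fst p))"
    and "((\<lambda>t. g (fst p, t)) has_vector_derivative g' (0, 1)) (at (snd p))"
proof -
  interpret bounded_linear g' by (rule has_derivative_bounded_linear[OF assms])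
  have "((\<lambda>s. (s, snd p)) has_derivative (\<lambda>s. (s, 0))) (at (fst p))"
    "((\<lambda>s. (fst p, s)) has_derivative (\<lambda>s. (0, s))) (at (snd p))"
    by (auto intro!: derivative_eq_intros)
  with assms have d: "((\<lambda>s. g (s, snd p)) has_derivative (\<lambda>s. g' (s, 0))) (at (fst p))"
    "((\<lambda>t. g (fst p, t)) has_derivative (\<lambda>t. g' (0, t))) (at (snd p))"
    by (auto intro: has_derivative_compose)
  have eq: "(\<lambda>s. g' (s, 0)) = (\<lambda>s. s *\<^sub>R g' (1, 0))"
    "(\<lambda>s. g' (0, s)) = (\<lambda>s. s *\<^sub>R g' (0, 1))"
    by (simp_all add: scaleR[symmetric])
  show "((\<lambda>s. g (s, snd p)) has_vector_derivative g' (1, 0)) (at (fst p))"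
    using d(1) unfolding has_vector_derivative_def eq .
  show "((\<lambda>t. g (fst p, t)) has_vector_derivative g' (0, 1)) (at (snd p))"
    using d(2) unfolding has_vector_derivative_def eq .
qed

lemma pd_eqI:
  assumes "(g has_derivative g') (at p)"
  shows "pd_u g p = g' (1, 0)" "pd_v g p = g' (0, 1)"
  using has_derivative_imp_pd[OF assms] by (auto simp: pd_u_def pd_v_def vector_derivative_at)

text \<open>A linear map is determined by its values on the two unit vectors. The sum, product and
  quotient rules for \<open>pd_u\<close> and \<open>pd_v\<close> are thereby the rules for
  \<open>has_derivative\<close> evaluated at \<open>(1, 0)\<close> and
  \<open>(0, 1)\<close>.\<close>

lemma has_derivative_pd:
  assumes "g differentiable (at p)"
  shows "(g has_derivative (\<lambda>h. fst h *\<^sub>R pd_u g p + snd h *\<^sub>R pd_v g p)) (at p)"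
proof -
  from assms obtain g' where g': "(g has_derivative g') (at p)" by (auto simp: differentiable_def)
  interpret bounded_linear g' by (rule has_derivative_bounded_linear[OF g'])
  have "g' h = fst h *\<^sub>R g' (1, 0) + snd h *\<^sub>R g' (0, 1)" for h
    using add[of "fst h *\<^sub>R (1, 0)" "snd h *\<^sub>R (0, 1)"] by (simp add: scaleR[symmetric])
  then have "g' = (\<lambda>h. fst h *\<^sub>R pd_u g p + snd h *\<^sub>R pd_v g p)"
    unfolding pd_eqI[OF g'] by (rule ext)
  with g' show ?thesis by simp
qed

lemma pd_has_vector_derivative:
  assumes "g differentiable (at (s, t))"
  shows "((\<lambda>s. g (s, t)) has_vector_derivative pd_u g (s, t)) (at s)"
    "((\<lambda>t. g (s, t)) has_vector_derivative pd_v g (s, t)) (at t)"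
  using has_derivative_imp_pd[OF has_derivative_pd[OF assms]] by simp_all

lemma smooth2_on_pd:
  assumes "open S" "smooth2_on S g"
  shows "smooth2_on S (pd_u g)" "smooth2_on S (pd_v g)"
proof -
  have "Ck_on k S (\<lambda>p. frechet_derivative g (at p) h)" for k h
    using assms(2) unfolding smooth2_on_def by (metis Ck_on.simps(2))
  then have *: "smooth2_on S (\<lambda>p. frechet_derivative g (at p) h)" for h
    by (simp add: smooth2_on_def)
  have eq: "pd_u g p = frechet_derivative g (at p) (1, 0)" "pd_v g p = frechet_derivative g (at p) (0, 1)"
    if "p \<in> S" for p
    using pd_eqI[of g "frechet_derivative g (at p)"] smooth2_on_differentiable[OF assms(2) that]
    by (auto simp: frechet_derivative_works)
  show "smooth2_on S (pd_u g)"
    using smooth2_on_cong[OF assms(1) eq(1)] * by simp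
  show "smooth2_on S (pd_v g)"
    using smooth2_on_cong[OF assms(1) eq(2)] * by simp
qed

lemma pd_cong:
  assumes "open S" "p \<in> S" "\<And>q. q \<in> S \<Longrightarrow> f q = g q" "g differentiable (at p)"
  shows "pd_u f p = pd_u g p" "pd_v f p = pd_v g p"
proof -
  have "(f has_derivative (\<lambda>h. fst h *\<^sub>R pd_u g p + snd h *\<^sub>R pd_v g p)) (at p)"
    by (rule has_derivative_transform_within_open[OF has_derivative_pd[OF assms(4)] assms(1,2)])
      (simp add: assms(3))
  from pd_eqI[OF this] show "pd_u f p = pd_u g p" "pd_v f p = pd_v g p" by simp_all
qed

lemma (in bounded_bilinear) pd:
  assumes "f differentiable (at p)" "g differentiable (at p)"
  shows "pd_u (\<lambda>q. prod (f q) (g q)) p = prod (f p) (pd_u g p) + prod (pd_u f p) (g p)"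
    "pd_v (\<lambda>q. prod (f q) (g q)) p = prod (f p) (pd_v g p) + prod (pd_v f p) (g p)"
  using pd_eqI[OF FDERIV[OF has_derivative_pd[OF assms(1)] has_derivative_pd[OF assms(2)]]] 
  by (simp_all add: scaleR_left scaleR_right zero_left zero_right)

lemma (in bounded_linear) pd:
  assumes "g differentiable (at p)"
  shows "pd_u (\<lambda>q. f (g q)) p = f (pd_u g p)" "pd_v (\<lambda>q. f (g q)) p = f (pd_v g p)"
  using pd_eqI[OF has_derivative[OF has_derivative_pd[OF assms]]] by simp_all

lemma pd_add:
  assumes "f differentiable (at p)" "g differentiable (at p)"
  shows "pd_u (\<lambda>q. f q + g q) p = pd_u f p + pd_u g p"
    "pd_v (\<lambda>q. f q + g q) p = pd_v f p + pd_v g p"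
  using pd_eqI[OF has_derivative_add[OF has_derivative_pd[OF assms(1)] has_derivative_pd[OF assms(2)]]]
  by simp_all

lemmas pd_mult = bounded_bilinear.pd[OF bounded_bilinear_mult]
lemmas pd_scaleR = bounded_bilinear.pd[OF bounded_bilinear_scaleR]

lemma pd_uminus:
  assumes "g differentiable (at p)"
  shows "pd_u (\<lambda>q. - g q) p = - pd_u g p" "pd_v (\<lambda>q. - g q) p = - pd_v g p"
  by (rule bounded_linear.pd[OF bounded_linear_minus[OF bounded_linear_ident] assms])+

lemma pd_divide:
  fixes f g :: "real \<times> real \<Rightarrow> real"
  assumes "f differentiable (at p)" "g differentiable (at p)" "g p \<noteq> 0"
  shows "pd_u (\<lambda>q. f q / g q) p = (pd_u f p * g p - f p * pd_u g p) / (g p)\<^sup>2"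
    "pd_v (\<lambda>q. f q / g q) p = (pd_v f p * g p - f p * pd_v g p) / (g p)\<^sup>2"
  using pd_eqI[OF has_derivative_divide[OF has_derivative_pd[OF assms(1)] has_derivative_pd[OF assms(2)] assms(3)]]
    assms(3)
  by (simp_all add: field_simps power2_eq_square)

lemma pd_ln_power:
  fixes f :: "real \<times> real \<Rightarrow> real"
  assumes "f differentiable (at p)" "f p > 0"
  shows "pd_u (\<lambda>q. ln (f q ^ n)) p = n * pd_u f p / f p"
    "pd_v (\<lambda>q. ln (f q ^ n)) p = n * pd_v f p / f p"
proof -
  have "((\<lambda>q. ln (f q ^ n)) has_derivative
      (\<lambda>h. n * f p ^ (n - 1) * (fst h * pd_u f p + snd h * pd_v f p) / f p ^ n)) (at p)"
    using assms(2) has_derivative_pd[OF assms(1)]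
    by (auto intro!: derivative_eq_intros simp: divide_inverse mult_ac)
  note * = pd_eqI[OF this]
  have **: "n * f p ^ (n - 1) * c / f p ^ n = n * c / f p" for c :: real
    using assms(2) by (cases n) (simp_all add: field_simps)
  show "pd_u (\<lambda>q. ln (f q ^ n)) p = n * pd_u f p / f p"
    using **[of "pd_u f p"] *(1) by simp
  show "pd_v (\<lambda>q. ln (f q ^ n)) p = n * pd_v f p / f p"
    using **[of "pd_v f p"] *(2) by simp
qed

section \<open>Oriented integrals and equality of mixed derivatives\<close>

text \<open>The oriented integral of \<open>g\<close> from \<open>s\<close> to \<open>t\<close>.
  Rescaling to the fixed interval \<open>{0..1}\<close> covers \<open>t < s\<close> without a case
  distinction and turns the endpoint into a parameter of the integrand.\<close>

definition segment_integral :: "(real \<Rightarrow> 'a::banach) \<Rightarrow> real \<Rightarrow> real \<Rightarrow> 'a" where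
  "segment_integral g s t = (t - s) *\<^sub>R integral {0..1} (\<lambda>\<tau>. g (s + \<tau> * (t - s)))"

lemma segment_in_interval:
  fixes s t :: real
  assumes "s \<in> {a..b}" "t \<in> {a..b}" "\<tau> \<in> {0..1}"
  shows "s + \<tau> * (t - s) \<in> {a..b}"
proof -
  have "(1 - \<tau>) *\<^sub>R s + \<tau> *\<^sub>R t \<in> {a..b}"
    using convexD_alt[OF convex_real_interval(5) assms(1,2)] assms(3) by auto
  then show ?thesis by (simp add: algebra_simps)
qed

lemma segment_integral_has_vector_derivative:
  fixes g :: "real \<Rightarrow> 'a::banach"
  assumes g: "continuous_on {a..b} g" and s: "s \<in> {a..b}" and t: "t \<in> {a..b}"
  shows "(segment_integral g s has_vector_derivative g t) (at t within {a..b})"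
proof -
  define G where "G = (\<lambda>t. integral {a..t} g)"
  have G: "(G has_vector_derivative g t) (at t within {a..b})" if "t \<in> {a..b}" for t
    unfolding G_def by (rule integral_has_vector_derivative[OF g that])
  \<comment> \<open>The composition of \<open>G\<close> with the affine path from \<open>s\<close>
    to \<open>t\<close> is a primitive of the rescaled integrand, whichever endpoint is
    larger.\<close>
  have eq: "segment_integral g s t = G t - G s"
    if t: "t \<in> {a..b}" for t
  proof -
    note in_ab = segment_in_interval[OF s t]
    have "((\<lambda>\<tau>. (t - s) *\<^sub>R g (s + \<tau> * (t - s))) has_integral
        G (s + 1 * (t - s)) - G (s + 0 * (t - s))) {0..1}"
    proof (rule fundamental_theorem_of_calculus)
      fix \<tau> :: real assume \<tau>: "\<tau> \<in> {0..1}"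
      have "((\<lambda>\<tau>. s + \<tau> * (t - s)) has_vector_derivative (t - s)) (at \<tau> within {0..1})"
        by (auto intro!: derivative_eq_intros)
      moreover have "(G has_vector_derivative g (s + \<tau> * (t - s)))
          (at (s + \<tau> * (t - s)) within (\<lambda>\<tau>. s + \<tau> * (t - s)) ` {0..1})"
        by (rule has_vector_derivative_within_subset[OF G[OF in_ab[OF \<tau>]]]) (use in_ab in blast)
      ultimately show "((\<lambda>\<tau>. G (s + \<tau> * (t - s))) has_vector_derivative
          (t - s) *\<^sub>R g (s + \<tau> * (t - s))) (at \<tau> within {0..1})"
        using vector_diff_chain_within by (force simp: o_def)
    qed simp
    from integral_unique[OF this] show ?thesis by (simp add: segment_integral_def)
  qed
  have "((\<lambda>t. G t - G s) has_vector_derivative g t) (at t within {a..b})"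
    using G[OF t] by (auto intro!: derivative_eq_intros)
  then show ?thesis
    by (rule has_vector_derivative_transform[OF t _, rotated]) (simp add: eq)
qed

lemma segment_integral_self [simp]: "segment_integral g s s = 0"
  by (simp add: segment_integral_def)

lemma continuous_on_segment:
  fixes s t :: real
  assumes "continuous_on {a..b} g" "s \<in> {a..b}" "t \<in> {a..b}"
  shows "continuous_on {0..1} (\<lambda>\<tau>. g (s + \<tau> * (t - s)))"
  by (rule continuous_on_compose2[OF assms(1)])
    (auto intro!: continuous_intros dest: segment_in_interval[OF assms(2,3)])

lemma norm_segment_integral_le:
  fixes g :: "real \<Rightarrow> 'a::banach"
  assumes g: "continuous_on {a..b} g" and s: "s \<in> {a..b}" and t: "t \<in> {a..b}"
    and M: "\<And>x. x \<in> {a..b} \<Longrightarrow> norm (g x) \<le> M"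
  shows "norm (segment_integral g s t) \<le> \<bar>t - s\<bar> * M"
proof -
  have "norm (integral {0..1} (\<lambda>\<tau>. g (s + \<tau> * (t - s)))) \<le> M * (1 - 0)"
    using M segment_in_interval[OF s t]
    by (intro integral_bound continuous_on_segment[OF assms(1-3)]) auto
  then show ?thesis by (simp add: segment_integral_def mult_left_mono)
qed

lemma segment_integral_diff:
  fixes g h :: "real \<Rightarrow> 'a::banach"
  assumes "continuous_on {a..b} g" "continuous_on {a..b} h" and s: "s \<in> {a..b}" and t: "t \<in> {a..b}"
  shows "segment_integral g s t - segment_integral h s t = segment_integral (\<lambda>x. g x - h x) s t"
  using continuous_on_segment[OF assms(1) s t] continuous_on_segment[OF assms(2) s t]
  by (simp add: segment_integral_def integral_diff integrable_continuous_real scaleR_diff_right)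

text \<open>The endpoint and the second variable both enter through the integrand over
  \<open>{0..1}\<close>, so joint continuity is that of an integral with parameters.\<close>

lemma continuous_on_segment_integral:
  fixes F :: "real \<times> real \<Rightarrow> 'a::banach"
  assumes F: "continuous_on ({a..b} \<times> J) F" and s: "s \<in> {a..b}"
  shows "continuous_on ({a..b} \<times> J) (\<lambda>(u, v). segment_integral (\<lambda>x. F (x, v)) s u)"
proof -
  have "continuous_on (({a..b} \<times> J) \<times> cbox 0 1) (\<lambda>(p, \<tau>). F (s + \<tau> * (fst p - s), snd p))"
    unfolding split_beta
    by (rule continuous_on_compose2[OF F])
      (use segment_in_interval[OF s] in \<open>auto intro!: continuous_intros\<close>)
  from integral_continuous_on_param[OF this] show ?thesis
    unfolding segment_integral_def split_beta by (auto intro!: continuous_intros)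
qed

text \<open>Write \<open>g\<close> as its value on the left edge of a small box plus the integral of
  \<open>pd_u g\<close>, differentiate under the integral sign in the second variable, and then
  differentiate the resulting integral in its endpoint.\<close>

lemma pd_commute:
  fixes g :: "real \<times> real \<Rightarrow> 'a::banach"
  assumes "open S" "smooth2_on S g" "p \<in> S"
  shows "pd_u (pd_v g) p = pd_v (pd_u g) p"
proof -
  obtain u v where p: "p = (u, v)" by (cases p)
  obtain T U where TU: "open T" "open U" "u \<in> T" "v \<in> U" "T \<times> U \<subseteq> S"
    using assms(1,3) p by (auto elim: open_prod_elim)
  obtain d where d: "d > 0" "cball u d \<subseteq> T" using TU open_contains_cball by blast
  obtain e where e: "e > 0" "cball v e \<subseteq> U" using TU open_contains_cball by blast
  define a b c' d' where "a = u - d" and "b = u + d" and "c' = v - e" and "d' = v + e"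
  have box: "(s, t) \<in> S" if "s \<in> {a..b}" "t \<in> {c'..d'}" for s t
    using that d(2) e(2) by (intro subsetD[OF TU(5)]) (auto simp: a_def b_def c'_def d'_def cball_eq_atLeastAtMost)
  have sm: "smooth2_on S (pd_u g)" "smooth2_on S (pd_v g)"
    "smooth2_on S (pd_v (pd_u g))" "smooth2_on S (pd_u (pd_v g))"
    using assms by (auto intro: smooth2_on_pd)
  note diff = smooth2_on_differentiable
  have cont: "continuous_on ({c'..d'} \<times> {a..b}) (\<lambda>(t, s). pd_v (pd_u g) (s, t))"
    unfolding split_beta
    by (rule continuous_on_compose2[OF smooth2_on_continuous_on[OF sm(3)]])
      (auto intro!: continuous_intros box)
  have cont1: "continuous_on {a..b} (\<lambda>s. pd_u g (s, t))" "continuous_on {a..b} (\<lambda>s. pd_v (pd_u g) (s, t))"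
    if "t \<in> {c'..d'}" for t
    using that
    by (auto intro!: continuous_on_compose2[OF smooth2_on_continuous_on[OF sm(1)]]
        continuous_on_compose2[OF smooth2_on_continuous_on[OF sm(3)]] continuous_intros box)
  have ftc: "g (s, t) = g (a, t) + integral {a..s} (\<lambda>r. pd_u g (r, t))"
    if st: "s \<in> {a..b}" "t \<in> {c'..d'}" for s t
  proof -
    have "((\<lambda>r. pd_u g (r, t)) has_integral g (s, t) - g (a, t)) {a..s}"
      using st by (intro fundamental_theorem_of_calculus)
        (auto intro!: has_vector_derivative_at_within pd_has_vector_derivative diff[OF assms(2)] box)
    from integral_unique[OF this] show ?thesis by simp
  qed
  have pdv: "pd_v g (s, v) = pd_v g (a, v) + integral {a..s} (\<lambda>r. pd_v (pd_u g) (r, v))"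
    if s: "s \<in> {a..b}" for s
  proof -
    have v: "v \<in> {c'..d'}" "v \<in> interior {c'..d'}" using e by (auto simp: c'_def d'_def)
    have "((\<lambda>t. integral (cbox a s) (\<lambda>r. pd_u g (r, t))) has_vector_derivative
        integral (cbox a s) (\<lambda>r. pd_v (pd_u g) (r, v))) (at v within {c'..d'})"
      using s v 
      by (intro leibniz_rule_vector_derivative)
       (auto intro!: has_vector_derivative_at_within pd_has_vector_derivative diff[OF sm(1)] box
          integrable_continuous_real continuous_on_subset[OF cont1(1)] continuous_on_subset[OF cont])
    then have "((\<lambda>t. g (a, t) + integral (cbox a s) (\<lambda>r. pd_u g (r, t))) has_vector_derivative
        pd_v g (a, v) + integral (cbox a s) (\<lambda>r. pd_v (pd_u g) (r, v))) (at v within {c'..d'})"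
      by (rule has_vector_derivative_add[OF has_vector_derivative_at_within[OF
              pd_has_vector_derivative(2)[OF diff[OF assms(2) box]]], rotated 2])
        (use s v in auto)
    then have "((\<lambda>t. g (s, t)) has_vector_derivative
        pd_v g (a, v) + integral (cbox a s) (\<lambda>r. pd_v (pd_u g) (r, v))) (at v within {c'..d'})"
      by (rule has_vector_derivative_transform[OF v(1) _, rotated]) (use ftc[OF s] in simp)
    then have "((\<lambda>t. g (s, t)) has_vector_derivative
        pd_v g (a, v) + integral {a..s} (\<lambda>r. pd_v (pd_u g) (r, v))) (at v)"
      by (simp only: at_within_interior[OF v(2)] box_real)
    with pd_has_vector_derivative(2)[OF diff[OF assms(2) box[OF s v(1)]]] show ?thesis
      by (rule vector_derivative_unique_at)
  qed
  have u: "u \<in> {a..b}" "u \<in> interior {a..b}" using d by (auto simp: a_def b_def)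
  have v: "v \<in> {c'..d'}" using e by (auto simp: c'_def d'_def)
  have "((\<lambda>s. pd_v g (a, v) + integral {a..s} (\<lambda>r. pd_v (pd_u g) (r, v))) has_vector_derivative
      0 + pd_v (pd_u g) (u, v)) (at u within {a..b})"
    by (intro derivative_intros integral_has_vector_derivative cont1 u v)
  then have "((\<lambda>s. pd_v g (s, v)) has_vector_derivative 0 + pd_v (pd_u g) (u, v)) (at u within {a..b})"
    by (rule has_vector_derivative_transform[OF u(1) _, rotated]) (rule pdv)
  then have "((\<lambda>s. pd_v g (s, v)) has_vector_derivative pd_v (pd_u g) (u, v)) (at u)"
    by (simp only: at_within_interior[OF u(2)] add_0_left)
  with pd_has_vector_derivative(1)[OF diff[OF sm(2) box[OF u(1) v]]] show ?thesis
    unfolding p by (rule vector_derivative_unique_at)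
qed

subsection \<open>Linear Frobenius systems\<close>

lemma has_vector_derivative_norm_le:
  fixes g :: "real \<Rightarrow> 'a::real_normed_vector"
  assumes "\<And>x. x \<in> {a..b} \<Longrightarrow> (g has_vector_derivative g' x) (at x within {a..b})"
    and "\<And>x. x \<in> {a..b} \<Longrightarrow> norm (g' x) \<le> M" "s \<in> {a..b}" "t \<in> {a..b}"
  shows "norm (g t - g s) \<le> M * \<bar>t - s\<bar>"
proof -
  have "0 \<le> M" using assms(2)[OF assms(3)] norm_ge_zero order_trans by blast
  have "norm (g t - g s) \<le> M * norm (t - s)"
  proof (rule differentiable_bound[where S = "{a..b}" and f' = "\<lambda>x h. h *\<^sub>R g' x"])
    show "onorm (\<lambda>h. h *\<^sub>R g' x) \<le> M" if "x \<in> {a..b}" for x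
      using assms(2)[OF that] \<open>0 \<le> M\<close>
      by (intro onorm_bound) (auto simp: mult.commute[of M] intro!: mult_left_mono)
  qed (use assms in \<open>auto simp: has_vector_derivative_def\<close>)
  then show ?thesis by simp
qed

text \<open>Bootstrapping: if \<open>X\<close> is of class \<open>k\<close>, so is the right hand
  side of the system, and hence \<open>X\<close> is of class \<open>Suc k\<close>.\<close>

lemma smooth2_on_linear_system:
  assumes S: "open S" and A: "smooth2_on S A" and B: "smooth2_on S B"
    and X: "\<And>p. p \<in> S \<Longrightarrow>
      (X has_derivative (\<lambda>h. fst h *\<^sub>R blinfun_apply (A p) (X p) + snd h *\<^sub>R blinfun_apply (B p) (X p))) (at p)"
  shows "smooth2_on S X"
proof -
  have "Ck_on k S X" for k
  proof (induction k)
    case 0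
    then show ?case
      using X by (auto intro!: continuous_at_imp_continuous_on has_derivative_continuous)
  next
    case (Suc k)
    have "Ck_on k S A" "Ck_on k S B" using A B by (auto simp: smooth2_on_def)
    then show ?case
      by (intro Ck_on_SucI[OF S X] Ck_on_add[OF S]
          bounded_bilinear.Ck_on[OF bounded_bilinear_scaleR S] Ck_on_const[OF S]
          bounded_bilinear.Ck_on[OF bounded_bilinear_blinfun_apply S] Suc.IH)
  qed
  then show ?thesis by (simp add: smooth2_on_def)
qed

text \<open>The constants serve three estimates. Picard iteration over two legs of length at most
  \<open>r\<close> contracts by \<open>2 * r * K \<le> 1 / 2\<close>. The error in the second
  equation shrinks by \<open>3 * r * K \<le> 3 / 4\<close>, where \<open>r \<le> 1\<close> bounds
  the side of the square by 2. Uniqueness along a segment uses \<open>2 * r * K \<le> 1 / 2\<close>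
  again. Among the derivatives only \<open>pd_v A\<close> is bounded, because integrability removes
  \<open>pd_u B\<close> from the equation of the error.\<close>

locale frobenius_box =
  fixes S :: "(real \<times> real) set" and A B :: "real \<times> real \<Rightarrow> 'a::banach \<Rightarrow>\<^sub>L 'a"
    and u0 v0 r K :: real
  assumes S: "open S" and smA: "smooth2_on S A" and smB: "smooth2_on S B"
    and compat: "\<And>p. p \<in> S \<Longrightarrow> pd_v A p + (A p o\<^sub>L B p) = pd_u B p + (B p o\<^sub>L A p)"
    and r: "0 < r" "r \<le> 1" "4 * (r * K) \<le> 1"
    and box: "{u0 - r..u0 + r} \<times> {v0 - r..v0 + r} \<subseteq> S"
    and bound: "\<And>p. p \<in> {u0 - r..u0 + r} \<times> {v0 - r..v0 + r} \<Longrightarrow>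
      norm (A p) \<le> K \<and> norm (B p) \<le> K \<and> norm (pd_v A p) \<le> K"
begin

abbreviation "I \<equiv> {u0 - r..u0 + r}"
abbreviation "J \<equiv> {v0 - r..v0 + r}"

lemma centre: "u0 \<in> I" "v0 \<in> J"
  using r by auto

lemma K_nonneg: "0 \<le> K"
  using bound[of "(u0, v0)"] centre norm_ge_zero order_trans by blast

lemma norm_blinfun_le: "norm L \<le> K \<Longrightarrow> norm w \<le> M \<Longrightarrow> norm (blinfun_apply L w) \<le> K * M"
  using norm_blinfun[of L w] K_nonneg by (smt (verit) mult_mono norm_ge_zero)

lemma cont:
  "continuous_on (I \<times> J) A" "continuous_on (I \<times> J) B"
  "continuous_on (I \<times> J) (pd_v A)" "continuous_on (I \<times> J) (pd_u B)"
  using smooth2_on_continuous_on smA smB smooth2_on_pd[OF S smA] smooth2_on_pd[OF S smB]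
    continuous_on_subset[OF _ box]
  by blast+

lemma continuous_on_slice:
  assumes "continuous_on (I \<times> J) g"
  shows "v \<in> J \<Longrightarrow> continuous_on I (\<lambda>u. g (u, v))" "u \<in> I \<Longrightarrow> continuous_on J (\<lambda>v. g (u, v))"
  by (rule continuous_on_compose2[OF assms]; auto intro!: continuous_intros)+

lemma continuous_on_apply:
  assumes "continuous_on (I \<times> J) g" "continuous_on (I \<times> J) L"
  shows "continuous_on (I \<times> J) (\<lambda>p. blinfun_apply (L p) (g p))"
  using assms by (intro continuous_intros)

text \<open>Picard iteration for the system along the segments (u0, v0) -- (u0, v) -- (u, v).\<close>

lemma fixed_point:
  "\<exists>X. continuous_on (I \<times> J) X \<and> (\<forall>u\<in>I. \<forall>v\<in>J. X (u, v) = w0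
      + segment_integral (\<lambda>t. B (u0, t) (X (u0, t))) v0 v
      + segment_integral (\<lambda>s. A (s, v) (X (s, v))) u0 u)"
proof -
  define T where "T X = (\<lambda>(u, v). w0
      + segment_integral (\<lambda>t. B (u0, t) (X (u0, t))) v0 v
      + segment_integral (\<lambda>s. A (s, v) (X (s, v))) u0 u)" for X :: "real \<times> real \<Rightarrow> 'a"
  have Q: "cbox (u0 - r, v0 - r) (u0 + r, v0 + r) = I \<times> J"
    by (simp add: cbox_Pair_eq)
  have ne: "(u0 - r, v0 - r) \<bullet> i \<le> (u0 + r, v0 + r) \<bullet> i" if "i \<in> Basis" for i
    using that r by (auto simp: Basis_prod_def)
  have contT: "continuous_on (I \<times> J) (T X)" if X: "continuous_on (I \<times> J) X" for X
  proof -
    have "continuous_on J (segment_integral (\<lambda>t. B (u0, t) (X (u0, t))) v0)"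
      by (rule continuous_on_vector_derivative[OF segment_integral_has_vector_derivative[OF
          continuous_on_slice(2)[OF continuous_on_apply[OF X cont(2)] centre(1)] centre(2)]])
    then have "continuous_on (I \<times> J) (\<lambda>p. segment_integral (\<lambda>t. B (u0, t) (X (u0, t))) v0 (snd p))"
      by (rule continuous_on_compose2) (auto intro!: continuous_intros)
    moreover have "continuous_on (I \<times> J) (\<lambda>p. segment_integral (\<lambda>s. A (s, snd p) (X (s, snd p))) u0 (fst p))"
      using continuous_on_segment_integral[OF continuous_on_apply[OF X cont(1)] centre(1)]
      by (simp add: split_beta)
    ultimately show ?thesis
      unfolding T_def split_beta by (intro continuous_intros)
  qed
  \<comment> \<open>The fixed point is sought among the bounded continuous functions on the whole
    plane, a complete space. Clamping the argument to the square extends the image under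
    \<open>T\<close>, whose continuity is known on the square only.\<close>
  have "\<exists>Y. \<forall>p. apply_bcontfun Y p = T (apply_bcontfun X) (clamp (u0 - r, v0 - r) (u0 + r, v0 + r) p)"
    for X :: "(real \<times> real) \<Rightarrow>\<^sub>C 'a"
    using continuous_on_cbox_bcontfunE[OF contT[OF continuous_on_apply_bcontfun, folded Q]] by metis
  then obtain \<Phi> :: "((real \<times> real) \<Rightarrow>\<^sub>C 'a) \<Rightarrow> ((real \<times> real) \<Rightarrow>\<^sub>C 'a)" where
    \<Phi>: "apply_bcontfun (\<Phi> X) p = T (apply_bcontfun X) (clamp (u0 - r, v0 - r) (u0 + r, v0 + r) p)" for X p
    by metis
  have "dist (\<Phi> X) (\<Phi> Y) \<le> 1 / 2 * dist X Y" for X Y :: "(real \<times> real) \<Rightarrow>\<^sub>C 'a"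
  proof (rule dist_bound)
    fix p
    obtain u v where uv: "clamp (u0 - r, v0 - r) (u0 + r, v0 + r) p = (u, v)" by fastforce
    have in_box: "u \<in> I" "v \<in> J"
      using clamp_in_interval[of "(u0 - r, v0 - r)" "(u0 + r, v0 + r)" p] ne unfolding uv Q by auto
    define dB where "dB = (\<lambda>t. B (u0, t) (X (u0, t)) - B (u0, t) (Y (u0, t)))"
    define dA where "dA = (\<lambda>s. A (s, v) (X (s, v)) - A (s, v) (Y (s, v)))"
    have cB: "continuous_on J (\<lambda>t. B (u0, t) (Z (u0, t)))" and cA: "continuous_on I (\<lambda>s. A (s, v) (Z (s, v)))"
      for Z :: "(real \<times> real) \<Rightarrow>\<^sub>C 'a"
      using continuous_on_slice continuous_on_apply cont centre in_box continuous_on_apply_bcontfun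
      by blast+
    have le: "norm (L (X q) - L (Y q)) \<le> K * dist X Y" if "norm L \<le> K" for L :: "'a \<Rightarrow>\<^sub>L 'a" and q
      unfolding blinfun.diff_right[symmetric] using dist_bounded[of X q Y]
      by (intro norm_blinfun_le that) (simp add: dist_norm)
    have "norm (segment_integral dB v0 v) \<le> \<bar>v - v0\<bar> * (K * dist X Y)"
      unfolding dB_def
      by (rule norm_segment_integral_le[OF continuous_on_diff[OF cB cB] centre(2) in_box(2)])
        (use bound centre in \<open>auto intro!: le\<close>)
    also have "\<dots> \<le> r * (K * dist X Y)"
      using in_box K_nonneg by (intro mult_right_mono) auto
    finally have 1: "norm (segment_integral dB v0 v) \<le> r * (K * dist X Y)" .
    have "norm (segment_integral dA u0 u) \<le> \<bar>u - u0\<bar> * (K * dist X Y)"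
      unfolding dA_def
      by (rule norm_segment_integral_le[OF continuous_on_diff[OF cA cA] centre(1) in_box(1)])
        (use bound in_box in \<open>auto intro!: le\<close>)
    also have "\<dots> \<le> r * (K * dist X Y)"
      using in_box K_nonneg by (intro mult_right_mono) auto
    finally have 2: "norm (segment_integral dA u0 u) \<le> r * (K * dist X Y)" .
    have "\<Phi> X p - \<Phi> Y p = segment_integral dB v0 v + segment_integral dA u0 u"
      unfolding \<Phi> uv dA_def dB_def
        segment_integral_diff[OF cA cA centre(1) in_box(1), symmetric]
        segment_integral_diff[OF cB cB centre(2) in_box(2), symmetric]
      by (simp add: T_def)
    with 1 2 have "norm (\<Phi> X p - \<Phi> Y p) \<le> 2 * (r * K) * dist X Y"
      using norm_triangle_ineq[of "segment_integral dB v0 v" "segment_integral dA u0 u"] by simp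
    also have "\<dots> \<le> 1 / 2 * dist X Y"
      using r by (intro mult_right_mono) auto
    finally show "dist (\<Phi> X p) (\<Phi> Y p) \<le> 1 / 2 * dist X Y" by (simp add: dist_norm)
  qed
  then obtain X where X: "\<Phi> X = X"
    using banach_fix_type[of "1 / 2" \<Phi>] by auto
  show ?thesis
  proof (intro exI[of _ "apply_bcontfun X"] conjI ballI)
    fix u v assume "u \<in> I" "v \<in> J"
    then have "(u, v) \<in> cbox (u0 - r, v0 - r) (u0 + r, v0 + r)" by (simp add: Q)
    then have "apply_bcontfun X (u, v) = T X (u, v)"
      using \<Phi>[of X "(u, v)"] by (simp add: X)
    then show "apply_bcontfun X (u, v) = w0
      + segment_integral (\<lambda>t. B (u0, t) (X (u0, t))) v0 v
      + segment_integral (\<lambda>s. A (s, v) (X (s, v))) u0 u"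
      by (simp add: T_def)
  qed simp
qed

lemma solution_on_closed_box:
  "\<exists>X. continuous_on (I \<times> J) X \<and> X (u0, v0) = w0 \<and> (\<forall>u\<in>I. \<forall>v\<in>J.
      ((\<lambda>u. X (u, v)) has_vector_derivative A (u, v) (X (u, v))) (at u within I) \<and>
      ((\<lambda>v. X (u, v)) has_vector_derivative B (u, v) (X (u, v))) (at v within J))"
proof -
  obtain X where X: "continuous_on (I \<times> J) X"
    and eq: "\<And>u v. u \<in> I \<Longrightarrow> v \<in> J \<Longrightarrow> X (u, v) = w0
      + segment_integral (\<lambda>t. B (u0, t) (X (u0, t))) v0 v
      + segment_integral (\<lambda>s. A (s, v) (X (s, v))) u0 u"
    using fixed_point[of w0] by blast
  note AX = continuous_on_apply[OF X cont(1)] and BX = continuous_on_apply[OF X cont(2)]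
  have Xu: "((\<lambda>u. X (u, v)) has_vector_derivative A (u, v) (X (u, v))) (at u within I)"
    if uv: "u \<in> I" "v \<in> J" for u v
  proof -
    have "((\<lambda>u. (w0 + segment_integral (\<lambda>t. B (u0, t) (X (u0, t))) v0 v)
        + segment_integral (\<lambda>s. A (s, v) (X (s, v))) u0 u) has_vector_derivative
        0 + A (u, v) (X (u, v))) (at u within I)"
      by (rule has_vector_derivative_add[OF has_vector_derivative_const
            segment_integral_has_vector_derivative[OF continuous_on_slice(1)[OF AX uv(2)] centre(1) uv(1)]])
    then show ?thesis
      unfolding add_0_left
      by (rule has_vector_derivative_transform[OF uv(1) _, rotated]) (rule eq[OF _ uv(2)])
  qed
  have X0v: "((\<lambda>v. X (u0, v)) has_vector_derivative B (u0, v) (X (u0, v))) (at v within J)"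
    if v: "v \<in> J" for v
  proof -
    have "((\<lambda>v. w0 + segment_integral (\<lambda>t. B (u0, t) (X (u0, t))) v0 v) has_vector_derivative
        0 + B (u0, v) (X (u0, v))) (at v within J)"
      by (rule has_vector_derivative_add[OF has_vector_derivative_const
            segment_integral_has_vector_derivative[OF continuous_on_slice(2)[OF BX centre(1)] centre(2) v]])
    then show ?thesis
      unfolding add_0_left
      by (rule has_vector_derivative_transform[OF v _, rotated]) (use eq[OF centre(1)] in simp)
  qed
  txt \<open>The fixed point solves the equation in u by construction. Its defect R in the equation in v
    satisfies a linear integral equation by the compatibility condition, so it vanishes.\<close>
  define c where "c = v0 - r"
  have J: "J = {c..v0 + r}" and c: "c \<in> J" using r by (auto simp: c_def)
  \<comment> \<open>Starting at the lower edge \<open>c\<close> and not at \<open>v0\<close> keeps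
    \<open>{c..v}\<close> an ordinary interval for every \<open>v\<close> in
    \<open>J\<close>.\<close>
  define P where "P = (\<lambda>u v. X (u, c) + integral {c..v} (\<lambda>t. B (u, t) (X (u, t))))"
  define R where "R = (\<lambda>u v. X (u, v) - P u v)"
  have Pv: "(P u has_vector_derivative B (u, v) (X (u, v))) (at v within J)"
    if uv: "u \<in> I" "v \<in> J" for u v
  proof -
    have "(P u has_vector_derivative 0 + B (u, v) (X (u, v))) (at v within J)"
      unfolding P_def
      by (rule has_vector_derivative_add[OF has_vector_derivative_const])
        (use integral_has_vector_derivative[OF continuous_on_slice(2)[OF BX uv(1)] uv(2)] in \<open>simp add: c_def\<close>)
    then show ?thesis by simp
  qed
  have sub: "{c..v} \<subseteq> J" if "v \<in> J" for v using that by (auto simp: c_def)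
  have contP: "continuous_on J (P u)" if "u \<in> I" for u
    by (rule continuous_on_vector_derivative[OF Pv[OF that]])
  have Ru: "((\<lambda>u. R u v) has_vector_derivative
      A (u, v) (R u v) - integral {c..v} (\<lambda>t. pd_v A (u, t) (R u t))) (at u within I)"
    if uv: "u \<in> I" "v \<in> J" for u v
  proof -
    define G where "G = (\<lambda>u t. pd_u B (u, t) (X (u, t)) + B (u, t) (A (u, t) (X (u, t))))"
    have "((\<lambda>u. integral (cbox c v) (\<lambda>t. B (u, t) (X (u, t)))) has_vector_derivative
        integral (cbox c v) (G u)) (at u within I)"
    proof (rule leibniz_rule_vector_derivative)
      fix u t assume "u \<in> I" "t \<in> cbox c v"
      then have ut: "u \<in> I" "t \<in> J" using sub[OF uv(2)] by auto
      have "(u, t) \<in> S" using ut box by blast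
      have "((\<lambda>u. B (u, t)) has_vector_derivative pd_u B (u, t)) (at u within I)"
        by (rule has_vector_derivative_at_within[OF pd_has_vector_derivative(1)[OF
                smooth2_on_differentiable[OF smB \<open>(u, t) \<in> S\<close>]]])
      from bounded_bilinear.has_vector_derivative[OF bounded_bilinear_blinfun_apply this Xu[OF ut]]
      show "((\<lambda>u. B (u, t) (X (u, t))) has_vector_derivative G u t) (at u within I)"
        by (simp add: G_def add.commute)
    next
      fix u assume "u \<in> I"
      then show "(\<lambda>t. B (u, t) (X (u, t))) integrable_on cbox c v"
        using continuous_on_subset[OF continuous_on_slice(2)[OF BX] sub[OF uv(2)]]
        by (intro integrable_continuous) simp
    next
      have "continuous_on (I \<times> J) (\<lambda>p. pd_u B p (X p) + B p (A p (X p)))"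
        by (intro continuous_intros cont X)
      then have "continuous_on (I \<times> J) (\<lambda>(u, t). G u t)"
        by (simp add: G_def split_beta)
      then show "continuous_on (I \<times> cbox c v) (\<lambda>(u, t). G u t)"
        by (rule continuous_on_subset) (use sub[OF uv(2)] in auto)
    qed (use uv in auto)
    then have "((\<lambda>u. integral {c..v} (\<lambda>t. B (u, t) (X (u, t)))) has_vector_derivative
        integral {c..v} (G u)) (at u within I)" by simp
    from has_vector_derivative_diff[OF Xu[OF uv] has_vector_derivative_add[OF Xu[OF uv(1) c] this]]
    have Ru: "((\<lambda>u. R u v) has_vector_derivative
        A (u, v) (X (u, v)) - (A (u, c) (X (u, c)) + integral {c..v} (G u))) (at u within I)"
      by (simp add: R_def P_def)
    \<comment> \<open>\<open>H\<close> is the derivative in \<open>t\<close> of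
      \<open>A (u, t) (P u t)\<close>. Its integral replaces the boundary terms at \<open>v\<close>
      and \<open>c\<close>, so that everything stands under one integral, where integrability
      reduces \<open>H - G\<close> to a term in \<open>R\<close> alone.\<close>
    define H where "H = (\<lambda>t. pd_v A (u, t) (P u t) + A (u, t) (B (u, t) (X (u, t))))"
    have "(H has_integral A (u, v) (P u v) - A (u, c) (P u c)) {c..v}"
    proof (rule fundamental_theorem_of_calculus)
      show "c \<le> v" using uv by (simp add: c_def)
      fix t assume "t \<in> {c..v}"
      then have t: "t \<in> J" using sub[OF uv(2)] by auto
      have "(u, t) \<in> S" using uv t box by blast
      have "((\<lambda>t. A (u, t)) has_vector_derivative pd_v A (u, t)) (at t within J)"
        by (rule has_vector_derivative_at_within[OF pd_has_vector_derivative(2)[OF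
                smooth2_on_differentiable[OF smA \<open>(u, t) \<in> S\<close>]]])
      from bounded_bilinear.has_vector_derivative[OF bounded_bilinear_blinfun_apply this Pv[OF uv(1) t]]
      have "((\<lambda>t. A (u, t) (P u t)) has_vector_derivative H t) (at t within J)"
        by (simp add: H_def add.commute)
      then show "((\<lambda>t. A (u, t) (P u t)) has_vector_derivative H t) (at t within {c..v})"
        by (rule has_vector_derivative_within_subset) (rule sub[OF uv(2)])
    qed
    then have H: "integral {c..v} H = A (u, v) (P u v) - A (u, c) (X (u, c))" "H integrable_on {c..v}"
      by (auto simp: P_def integral_unique)
    have "continuous_on J (G u)"
      unfolding G_def
      by (intro continuous_intros) (use cont X uv(1) continuous_on_slice(2) in blast)+
    then have Gi: "G u integrable_on {c..v}"
      by (rule integrable_continuous_real[OF continuous_on_subset[OF _ sub[OF uv(2)]]])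
    have HG: "H t - G u t = - (pd_v A (u, t) (R u t))" if "t \<in> {c..v}" for t
    proof -
      have "(u, t) \<in> S" using that sub[OF uv(2)] uv box by auto
      from arg_cong[OF compat[OF this], of "\<lambda>L. L (X (u, t))"] show ?thesis
        by (simp add: H_def G_def R_def blinfun.add_left blinfun.diff_right algebra_simps)
    qed
    have "A (u, v) (X (u, v)) - (A (u, c) (X (u, c)) + integral {c..v} (G u))
        = A (u, v) (R u v) + (integral {c..v} H - integral {c..v} (G u))"
      by (simp add: H R_def blinfun.diff_right)
    also have "integral {c..v} H - integral {c..v} (G u) = integral {c..v} (\<lambda>t. - (pd_v A (u, t) (R u t)))"
      using integral_diff[OF H(2) Gi] HG by (metis (no_types, lifting) integral_cong)
    finally show ?thesis using Ru by (simp add: integral_neg)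
  qed
  have R0: "R u0 v = 0" if v: "v \<in> J" for v
  proof -
    have "((\<lambda>t. B (u0, t) (X (u0, t))) has_integral X (u0, v) - X (u0, c)) {c..v}"
      using v by (intro fundamental_theorem_of_calculus
          has_vector_derivative_within_subset[OF X0v]) (use sub[OF v] in \<open>auto simp: c_def\<close>)
    from integral_unique[OF this] show ?thesis by (simp add: R_def P_def)
  qed
  \<comment> \<open>\<open>R\<close> vanishes at \<open>u0\<close>, and its derivative in u is at
    most \<open>K * M\<close> plus \<open>K * M\<close> times the length of \<open>{c..v}\<close>,
    which is at most 2. A distance of at most \<open>r\<close> from \<open>u0\<close> leaves the
    factor \<open>3 * r * K \<le> 3 / 4\<close>.\<close>
  have step: "norm (R u v) \<le> 3 / 4 * M"
    if M: "\<And>u v. u \<in> I \<Longrightarrow> v \<in> J \<Longrightarrow> norm (R u v) \<le> M" and uv: "u \<in> I" "v \<in> J" for M u v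
  proof -
    have M0: "0 \<le> M" using M[OF uv] norm_ge_zero order_trans by blast
    have "norm (R u v - R u0 v) \<le> 3 * (K * M) * \<bar>u - u0\<bar>"
    proof (rule has_vector_derivative_norm_le[OF Ru[OF _ uv(2)] _ centre(1) uv(1)])
      fix s assume s: "s \<in> I"
      have 1: "norm (A (s, v) (R s v)) \<le> K * M"
        using bound s uv M by (intro norm_blinfun_le) auto
      have "continuous_on J (R s)"
        unfolding R_def by (intro continuous_intros continuous_on_slice(2)[OF X s] contP[OF s])
      then have cR: "continuous_on {c..v} (\<lambda>t. pd_v A (s, t) (R s t))"
        by (intro continuous_on_subset[OF _ sub[OF uv(2)]] continuous_intros
            continuous_on_slice(2)[OF cont(3) s])
      have "norm (integral {c..v} (\<lambda>t. pd_v A (s, t) (R s t))) \<le> K * M * (v - c)"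
        by (rule integral_bound[OF _ cR])
          (use s uv sub[OF uv(2)] bound M in \<open>auto intro!: norm_blinfun_le simp: c_def\<close>)
      also have "\<dots> \<le> K * M * 2"
        using uv r K_nonneg M0 by (intro mult_left_mono) (auto simp: c_def)
      finally have 2: "norm (integral {c..v} (\<lambda>t. pd_v A (s, t) (R s t))) \<le> K * M * 2" .
      show "norm (A (s, v) (R s v) - integral {c..v} (\<lambda>t. pd_v A (s, t) (R s t))) \<le> 3 * (K * M)"
        using norm_triangle_ineq4[of "A (s, v) (R s v)" "integral {c..v} (\<lambda>t. pd_v A (s, t) (R s t))"] 1 2
        by linarith
    qed
    also have "\<dots> \<le> 3 * (K * M) * r"
      using uv K_nonneg M0 by (intro mult_left_mono) auto
    also have "\<dots> = 3 / 4 * (4 * (r * K)) * M" by simp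
    also have "\<dots> \<le> 3 / 4 * 1 * M"
      using r M0 by (intro mult_right_mono mult_left_mono) auto
    finally show ?thesis by (simp add: R0[OF uv(2)])
  qed
  have R: "R u v = 0" if uv: "u \<in> I" "v \<in> J" for u v
  proof -
    obtain M where M: "norm (X p) \<le> M" "norm (B p (X p)) \<le> M" if "p \<in> I \<times> J" for p
    proof -
      have "compact (I \<times> J)" by (intro compact_Times) simp_all
      then have "bounded (X ` (I \<times> J))" "bounded ((\<lambda>p. B p (X p)) ` (I \<times> J))"
        using X BX compact_continuous_image compact_imp_bounded by blast+
      then obtain M1 M2 where "norm (X p) \<le> M1" "norm (B p (X p)) \<le> M2" if "p \<in> I \<times> J" for p
        unfolding bounded_iff by blast
      then show thesis using that[of "max M1 M2"] by (meson le_max_iff_disj)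
    qed
    \<comment> \<open>Two values of \<open>X\<close> and an integral over a length of at most 2 give
      the constant 4. From this first bound the factor 3/4 is iterated.\<close>
    have bounded: "norm (R u v) \<le> 4 * M" if uv: "u \<in> I" "v \<in> J" for u v
    proof -
      have "0 \<le> M" using M(1)[of "(u, v)"] uv norm_ge_zero order_trans by blast
      have "norm (integral {c..v} (\<lambda>t. B (u, t) (X (u, t)))) \<le> M * (v - c)"
        using uv sub[OF uv(2)]
        by (intro integral_bound continuous_on_subset[OF continuous_on_slice(2)[OF BX uv(1)] sub[OF uv(2)]])
          (auto simp: c_def intro!: M(2))
      also have "\<dots> \<le> M * 2" using uv r \<open>0 \<le> M\<close> by (intro mult_left_mono) (auto simp: c_def)
      finally have "norm (integral {c..v} (\<lambda>t. B (u, t) (X (u, t)))) \<le> M * 2" .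
      moreover have "norm (R u v) \<le> norm (X (u, v)) + (norm (X (u, c)) + norm (integral {c..v} (\<lambda>t. B (u, t) (X (u, t)))))"
        unfolding R_def P_def
        by (meson add_left_mono norm_triangle_ineq norm_triangle_ineq4 order_trans)
      moreover have "norm (X (u, v)) \<le> M" "norm (X (u, c)) \<le> M" using M(1) uv c by auto
      ultimately show ?thesis by linarith
    qed
    have "norm (R u v) \<le> (3 / 4) ^ n * (4 * M)" for n
      using uv
    proof (induction n arbitrary: u v)
      case (Suc n)
      with step[of "(3 / 4) ^ n * (4 * M)"] show ?case by simp
    qed (use bounded in simp)
    moreover have "(\<lambda>n. (3 / 4) ^ n * (4 * M)) \<longlonglongrightarrow> 0"
      by (intro tendsto_mult_left_zero LIMSEQ_realpow_zero) auto
    ultimately have "norm (R u v) \<le> 0"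
      by (intro LIMSEQ_le_const) auto
    then show ?thesis by simp
  qed
  have Xv: "((\<lambda>v. X (u, v)) has_vector_derivative B (u, v) (X (u, v))) (at v within J)"
    if uv: "u \<in> I" "v \<in> J" for u v
    by (rule has_vector_derivative_transform[OF uv(2) _ Pv[OF uv]]) (use R[OF uv(1)] in \<open>simp add: R_def\<close>)
  moreover have "X (u0, v0) = w0" using eq[OF centre] by simp
  ultimately show ?thesis using X Xu by blast
qed

abbreviation "I' \<equiv> {u0 - r<..<u0 + r}"
abbreviation "J' \<equiv> {v0 - r<..<v0 + r}"

lemma open_box: "open (I' \<times> J')" "I' \<times> J' \<subseteq> S" "(u0, v0) \<in> I' \<times> J'"
  using box r by (auto intro!: open_Times)

lemma solution:
  obtains X :: "real \<times> real \<Rightarrow> 'a" where "X (u0, v0) = w0" "smooth2_on (I' \<times> J') X"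
    "\<And>p. p \<in> I' \<times> J' \<Longrightarrow> pd_u X p = A p (X p)" "\<And>p. p \<in> I' \<times> J' \<Longrightarrow> pd_v X p = B p (X p)"
proof -
  obtain X where X: "continuous_on (I \<times> J) X" "X (u0, v0) = w0"
    and Xu: "\<And>u v. u \<in> I \<Longrightarrow> v \<in> J \<Longrightarrow>
      ((\<lambda>u. X (u, v)) has_vector_derivative A (u, v) (X (u, v))) (at u within I)"
    and Xv: "\<And>u v. u \<in> I \<Longrightarrow> v \<in> J \<Longrightarrow>
      ((\<lambda>v. X (u, v)) has_vector_derivative B (u, v) (X (u, v))) (at v within J)"
    using solution_on_closed_box[of w0] by blast
  have sub: "I' \<subseteq> I" "J' \<subseteq> J" by auto
  have der: "(X has_derivative (\<lambda>h. fst h *\<^sub>R A p (X p) + snd h *\<^sub>R B p (X p))) (at p)"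
    if p_in: "p \<in> I' \<times> J'" for p
  proof -
    obtain u v where p: "p = (u, v)" "u \<in> I'" "v \<in> J'" using p_in by blast
    \<comment> \<open>Existence of both partial derivatives alone would not give total
      differentiability; continuity of the derivative in v supplies the rest.\<close>
    have "((\<lambda>(x, y). X (x, y)) has_derivative
        (\<lambda>(tx, ty). tx *\<^sub>R A (u, v) (X (u, v)) + blinfun_scaleR_left (B (u, v) (X (u, v))) ty))
        (at (u, v) within I' \<times> J')"
    proof (rule has_derivative_partialsI[where fy = "\<lambda>x y. blinfun_scaleR_left (B (x, y) (X (x, y)))"])
      show "((\<lambda>x. X (x, v)) has_derivative (\<lambda>h. h *\<^sub>R A (u, v) (X (u, v)))) (at u within I')"
        using has_vector_derivative_within_subset[OF Xu[of u v] sub(1)] p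
        by (auto simp: has_vector_derivative_def)
      show "((\<lambda>y. X (x, y)) has_derivative blinfun_scaleR_left (B (x, y) (X (x, y)))) (at y within J')"
        if "x \<in> I'" "y \<in> J'" for x y
        using has_vector_derivative_within_subset[OF Xv[of x y] sub(2)] that
        by (auto simp: has_vector_derivative_def)
      have "continuous_on (I \<times> J) (\<lambda>p. blinfun_scaleR_left (B p (X p)))"
        by (intro continuous_intros cont X)
      then have "continuous_on (I' \<times> J') (\<lambda>(x, y). blinfun_scaleR_left (B (x, y) (X (x, y))))"
        unfolding split_beta prod.collapse by (rule continuous_on_subset) auto
      then show "continuous (at (u, v) within I' \<times> J') (\<lambda>(x, y). blinfun_scaleR_left (B (x, y) (X (x, y))))"
        unfolding continuous_on_eq_continuous_within using p(2,3) by blast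
    qed (use p in auto)
    then show ?thesis
      using at_within_open[OF p_in open_box(1)] by (simp add: p case_prod_beta')
  qed
  have sm: "smooth2_on (I' \<times> J') A" "smooth2_on (I' \<times> J') B"
    using smA smB open_box smooth2_on_subset by blast+
  show thesis
    by (rule that[OF X(2) smooth2_on_linear_system[OF open_box(1) sm der]])
      (use pd_eqI[OF der] in \<open>simp_all add: mem_Times_iff\<close>)
qed

text \<open>On the segment from the centre to \<open>p\<close> the difference solves a linear
  ordinary differential equation whose coefficient has norm at most
  \<open>2 * r * K \<le> 1 / 2\<close>. Where the norm of the difference is largest, the mean value
  estimate bounds it by half of itself.\<close>

lemma solution_unique:
  assumes X: "smooth2_on (I' \<times> J') X" and Y: "smooth2_on (I' \<times> J') Y" and init: "X (u0, v0) = Y (u0, v0)"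
    and Xuv: "\<And>p. p \<in> I' \<times> J' \<Longrightarrow> pd_u X p = A p (X p) \<and> pd_v X p = B p (X p)"
    and Yuv: "\<And>p. p \<in> I' \<times> J' \<Longrightarrow> pd_u Y p = A p (Y p) \<and> pd_v Y p = B p (Y p)"
    and p: "p \<in> I' \<times> J'"
  shows "X p = Y p"
proof -
  define \<gamma> where "\<gamma> = (\<lambda>t. (u0, v0) + t *\<^sub>R (p - (u0, v0)))"
  define g where "g = (\<lambda>t. X (\<gamma> t) - Y (\<gamma> t))"
  have \<gamma>: "\<gamma> t \<in> I' \<times> J'" if "t \<in> {0..1}" for t
  proof -
    have "convex (I' \<times> J')" by (intro convex_Times) auto
    moreover have "\<gamma> t = (1 - t) *\<^sub>R (u0, v0) + t *\<^sub>R p"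
      by (simp add: \<gamma>_def algebra_simps scaleR_Pair prod_eq_iff)
    ultimately show ?thesis
      using convexD_alt[OF _ open_box(3) p, of t] that by auto
  qed
  define D where "D = (\<lambda>q w. fst (p - (u0, v0)) *\<^sub>R A q w + snd (p - (u0, v0)) *\<^sub>R B q w)"
  have g: "(g has_vector_derivative D (\<gamma> t) (g t)) (at t within {0..1})" if t: "t \<in> {0..1}" for t
  proof -
    have \<gamma>': "(\<gamma> has_derivative (\<lambda>h. h *\<^sub>R (p - (u0, v0)))) (at t within {0..1})"
      unfolding \<gamma>_def by (auto intro!: derivative_eq_intros)
    have "((\<lambda>t. Z (\<gamma> t)) has_vector_derivative D (\<gamma> t) (Z (\<gamma> t))) (at t within {0..1})"
      if Z: "smooth2_on (I' \<times> J') Z"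
        "\<And>p. p \<in> I' \<times> J' \<Longrightarrow> pd_u Z p = A p (Z p) \<and> pd_v Z p = B p (Z p)" for Z
      using has_derivative_compose[OF \<gamma>' has_derivative_pd[OF smooth2_on_differentiable[OF Z(1) \<gamma>[OF t]]]]
      by (simp add: has_vector_derivative_def Z(2)[OF \<gamma>[OF t]] D_def algebra_simps)
    from has_vector_derivative_diff[OF this[OF X Xuv] this[OF Y Yuv]]
    show ?thesis unfolding g_def D_def by (simp add: blinfun.diff_right algebra_simps)
  qed
  then have "continuous_on {0..1} (\<lambda>t. norm (g t))"
    by (intro continuous_on_norm continuous_on_vector_derivative)
  then obtain m where m: "m \<in> {0..1}" "\<And>t. t \<in> {0..1} \<Longrightarrow> norm (g t) \<le> norm (g m)"
    using continuous_attains_sup[of "{0..1::real}" "\<lambda>t. norm (g t)"] by force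
  have "norm (g m - g 0) \<le> 1 / 2 * norm (g m) * \<bar>m - 0\<bar>"
  proof (rule has_vector_derivative_norm_le[OF g])
    fix t :: real assume t: "t \<in> {0..1}"
    have "norm (A (\<gamma> t) (g t)) \<le> K * norm (g m)" "norm (B (\<gamma> t) (g t)) \<le> K * norm (g m)"
      using bound[of "\<gamma> t"] \<gamma>[OF t] m(2)[OF t] by (auto intro!: norm_blinfun_le simp: less_imp_le mem_Times_iff)
    moreover have "\<bar>fst (p - (u0, v0))\<bar> \<le> r" "\<bar>snd (p - (u0, v0))\<bar> \<le> r" using p by auto
    ultimately have "norm (fst (p - (u0, v0)) *\<^sub>R A (\<gamma> t) (g t)) \<le> r * (K * norm (g m))"
      "norm (snd (p - (u0, v0)) *\<^sub>R B (\<gamma> t) (g t)) \<le> r * (K * norm (g m))"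
      using r by (auto simp del: fst_diff snd_diff intro!: mult_mono)
    then have "norm (D (\<gamma> t) (g t)) \<le> 2 * (r * (K * norm (g m)))"
      unfolding D_def by (intro norm_triangle_le) simp
    also have "\<dots> = 1 / 2 * ((4 * (r * K)) * norm (g m))" by simp
    also have "\<dots> \<le> 1 / 2 * (1 * norm (g m))"
      using r by (intro mult_left_mono mult_right_mono) auto
    finally show "norm (D (\<gamma> t) (g t)) \<le> 1 / 2 * norm (g m)" by simp
  qed (use m in auto)
  also have "\<dots> \<le> 1 / 2 * norm (g m) * 1" using m(1) by (intro mult_left_mono) auto
  finally have "norm (g m) = 0" by (simp add: g_def \<gamma>_def init)
  with m(2)[of 1] show ?thesis by (simp add: g_def \<gamma>_def)
qed

end

text \<open>The radius comes from bounds of \<open>A\<close>, \<open>B\<close> and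
  \<open>pd_v A\<close> on a compact square inside \<open>S\<close>. By linearity these bounds do
  not involve the solution, so one \<open>U\<close> works for all initial values.\<close>

theorem linear_frobenius:
  fixes A B :: "real \<times> real \<Rightarrow> 'a::banach \<Rightarrow>\<^sub>L 'a"
  assumes S: "open S" "smooth2_on S A" "smooth2_on S B" "q \<in> S"
    and compat: "\<And>p. p \<in> S \<Longrightarrow> pd_v A p + (A p o\<^sub>L B p) = pd_u B p + (B p o\<^sub>L A p)"
  obtains U where "open U" "convex U" "U \<subseteq> S" "q \<in> U"
    "\<And>w. \<exists>X. X q = w \<and> smooth2_on U X \<and> (\<forall>p\<in>U. pd_u X p = A p (X p) \<and> pd_v X p = B p (X p))"
    "\<And>X Y p. smooth2_on U X \<Longrightarrow> smooth2_on U Y \<Longrightarrow> X q = Y q \<Longrightarrow>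
      (\<And>p. p \<in> U \<Longrightarrow> pd_u X p = A p (X p) \<and> pd_v X p = B p (X p)) \<Longrightarrow>
      (\<And>p. p \<in> U \<Longrightarrow> pd_u Y p = A p (Y p) \<and> pd_v Y p = B p (Y p)) \<Longrightarrow> p \<in> U \<Longrightarrow> X p = Y p"
proof -
  obtain u0 v0 where q: "q = (u0, v0)" by (cases q)
  obtain T V where TV: "open T" "open V" "u0 \<in> T" "v0 \<in> V" "T \<times> V \<subseteq> S"
    using S(1,4) q by (auto elim: open_prod_elim)
  obtain d where d: "d > 0" "cball u0 d \<subseteq> T" using TV open_contains_cball by blast
  obtain e where e: "e > 0" "cball v0 e \<subseteq> V" using TV open_contains_cball by blast
  define s where "s = min d e"
  have "{u0 - s..u0 + s} \<subseteq> cball u0 d" "{v0 - s..v0 + s} \<subseteq> cball v0 e"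
    by (auto simp: s_def cball_eq_atLeastAtMost)
  then have "{u0 - s..u0 + s} \<subseteq> T" "{v0 - s..v0 + s} \<subseteq> V"
    using d(2) e(2) by blast+
  then have s: "s > 0" "{u0 - s..u0 + s} \<times> {v0 - s..v0 + s} \<subseteq> S"
    using d(1) e(1) TV(5) by (auto simp: s_def)
  let ?Q = "{u0 - s..u0 + s} \<times> {v0 - s..v0 + s}"
  have "compact ?Q" by (intro compact_Times) simp_all
  moreover have "continuous_on ?Q A" "continuous_on ?Q B" "continuous_on ?Q (pd_v A)"
    using s(2) S smooth2_on_pd[OF S(1,2)] by (auto intro: continuous_on_subset smooth2_on_continuous_on)
  ultimately have "bounded (A ` ?Q)" "bounded (B ` ?Q)" "bounded (pd_v A ` ?Q)"
    using compact_continuous_image compact_imp_bounded by blast+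
  then obtain K1 K2 K3 where K': "\<And>p. p \<in> ?Q \<Longrightarrow> norm (A p) \<le> K1" "\<And>p. p \<in> ?Q \<Longrightarrow> norm (B p) \<le> K2"
    "\<And>p. p \<in> ?Q \<Longrightarrow> norm (pd_v A p) \<le> K3"
    unfolding bounded_iff by (metis imageI)
  \<comment> \<open>The lower bound 1 makes \<open>1 / (4 * K)\<close> positive, and with it
    \<open>r\<close>.\<close>
  define K where "K = max 1 (max K1 (max K2 K3))"
  define r where "r = min s (min 1 (1 / (4 * K)))"
  have K: "1 \<le> K" by (simp add: K_def)
  have r: "0 < r" "r \<le> 1" "r \<le> s" using s K
    unfolding r_def by (auto simp only: min_less_iff_conj zero_less_divide_iff intro: min.coboundedI1 min.coboundedI2)
  have "r \<le> 1 / (4 * K)" by (simp add: r_def)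
  then have rK: "4 * (r * K) \<le> 1" using K by (simp add: field_simps)
  have sub: "{u0 - r..u0 + r} \<times> {v0 - r..v0 + r} \<subseteq> ?Q" using r by auto
  interpret frobenius_box S A B u0 v0 r K
  proof
    fix p assume "p \<in> {u0 - r..u0 + r} \<times> {v0 - r..v0 + r}"
    then have "p \<in> ?Q" using sub by blast
    then show "norm (A p) \<le> K \<and> norm (B p) \<le> K \<and> norm (pd_v A p) \<le> K"
      using K'[of p] by (auto simp: K_def)
  qed (use S compat r rK sub s in auto)
  show thesis
  proof (rule that[OF open_box(1) _ open_box(2)])
    show "convex (I' \<times> J')" by (intro convex_Times) auto
    show "\<exists>X. X q = w \<and> smooth2_on (I' \<times> J') X \<and>
        (\<forall>p\<in>I' \<times> J'. pd_u X p = A p (X p) \<and> pd_v X p = B p (X p))" for w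
      using solution[of w] unfolding q by metis
  qed (use open_box(3) solution_unique in \<open>auto simp: q\<close>)
qed

subsection \<open>Pseudo-orthonormal frames\<close>

lemma bounded_bilinear_mink: "bounded_bilinear mink"
  unfolding bilinear_conv_bounded_bilinear[symmetric] bilinear_def
  by (auto intro!: linearI simp: mink_def algebra_simps)

interpretation mink: bounded_bilinear mink
  by (rule bounded_bilinear_mink)

lemma mink_commute: "mink v w = mink w v"
  by (simp add: mink_def mult.commute)

lemmas mink_linear = mink.add_left mink.add_right mink.diff_left mink.diff_right
  mink.minus_left mink.minus_right mink.scaleR_left mink.scaleR_right mink.zero_left mink.zero_right

lemma mink_nondegenerate:
  assumes "\<And>w. mink v w = 0"
  shows "v = 0"
  using assms[of "axis 1 1"] assms[of "axis 2 1"] assms[of "axis 3 1"] assms[of "axis 4 1"]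
  by (simp add: mink_def axis_def vec_eq_iff forall_4)

definition mink_frame :: "real ^ 4 \<Rightarrow> real ^ 4 \<Rightarrow> real ^ 4 \<Rightarrow> real ^ 4 \<Rightarrow> bool" where
  "mink_frame x y n1 n2 \<longleftrightarrow>
     mink x x = 0 \<and> mink y y = 0 \<and> mink x y = - 1 \<and>
     mink n1 n1 = 1 \<and> mink n2 n2 = 1 \<and> mink n1 n2 = 0 \<and>
     mink x n1 = 0 \<and> mink x n2 = 0 \<and> mink y n1 = 0 \<and> mink y n2 = 0"

lemma mink_frameD:
  assumes "mink_frame x y n1 n2"
  shows "mink x x = 0" "mink y y = 0" "mink x y = - 1" "mink y x = - 1"
    "mink n1 n1 = 1" "mink n2 n2 = 1" "mink n1 n2 = 0" "mink n2 n1 = 0"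
    "mink x n1 = 0" "mink x n2 = 0" "mink y n1 = 0" "mink y n2 = 0"
    "mink n1 x = 0" "mink n2 x = 0" "mink n1 y = 0" "mink n2 y = 0"
  using assms mink_commute by (auto simp: mink_frame_def)

definition vec4 :: "real \<Rightarrow> real \<Rightarrow> real \<Rightarrow> real \<Rightarrow> real ^ 4" where
  "vec4 a b c d = (\<chi> i. if i = 1 then a else if i = 2 then b else if i = 3 then c else d)"

lemma vec4_nth [simp]:
  "vec4 a b c d $ 1 = a" "vec4 a b c d $ 2 = b" "vec4 a b c d $ 3 = c" "vec4 a b c d $ 4 = d"
  by (simp_all add: vec4_def)

definition frame_map :: "real ^ 4 \<Rightarrow> real ^ 4 \<Rightarrow> real ^ 4 \<Rightarrow> real ^ 4 \<Rightarrow> real ^ 4 \<Rightarrow> real ^ 4" where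
  "frame_map x y n1 n2 t = t $ 1 *\<^sub>R x + t $ 2 *\<^sub>R y + t $ 3 *\<^sub>R n1 + t $ 4 *\<^sub>R n2"

lemma linear_frame_map: "linear (frame_map x y n1 n2)"
  by (auto intro!: linearI simp: frame_map_def algebra_simps)

text \<open>Pairing a vanishing combination with the four vectors kills each coefficient, so
  \<open>frame_map\<close> is injective and, by dimension, onto. The signs come from
  \<open>mink x y = - 1\<close>: the coefficient of \<open>x\<close> is read off by pairing with
  \<open>- y\<close>.\<close>

lemma mink_frame_expand:
  assumes "mink_frame x y n1 n2"
  shows "w = - mink w y *\<^sub>R x - mink w x *\<^sub>R y + mink w n1 *\<^sub>R n1 + mink w n2 *\<^sub>R n2"
proof -
  note fr = mink_frameD[OF assms]
  have "inj (frame_map x y n1 n2)"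
    unfolding linear_injective_0[OF linear_frame_map]
  proof (intro allI impI)
    fix t assume t: "frame_map x y n1 n2 t = 0"
    have "mink (frame_map x y n1 n2 t) v = 0" for v by (simp add: t mink_linear)
    from this[of x] this[of y] this[of n1] this[of n2] show "t = 0"
      by (simp add: frame_map_def mink_linear fr vec_eq_iff forall_4)
  qed
  then have "surj (frame_map x y n1 n2)"
    by (rule linear_inj_imp_surj[OF linear_frame_map])
  then obtain t where "w = frame_map x y n1 n2 t" by (auto simp: surj_def)
  then show ?thesis
    by (simp add: frame_map_def mink_linear fr algebra_simps)
qed

text \<open>The expansions make \<open>frame_map\<close> onto, hence one-to-one. So the coordinates
  of the four vectors computed with \<open>mink\<close> must be the unit vectors, which are the ten
  product relations. This recovers the products after transport along the system.\<close>

lemma mink_frameI: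
  assumes "\<And>w. w = - mink w y *\<^sub>R x - mink w x *\<^sub>R y + mink w n1 *\<^sub>R n1 + mink w n2 *\<^sub>R n2"
  shows "mink_frame x y n1 n2"
proof -
  let ?M = "frame_map x y n1 n2"
  let ?t = "\<lambda>w. vec4 (- mink w y) (- mink w x) (mink w n1) (mink w n2)"
  have M: "?M (?t w) = w" for w
    using assms[of w] by (simp add: frame_map_def)
  then have "surj ?M" by (rule surjI)
  then have inj: "inj ?M" by (rule linear_surj_imp_inj[OF linear_frame_map])
  have "?M (vec4 1 0 0 0) = x" "?M (vec4 0 1 0 0) = y" "?M (vec4 0 0 1 0) = n1" "?M (vec4 0 0 0 1) = n2"
    by (simp_all add: frame_map_def)
  then have "?t x = vec4 1 0 0 0" "?t y = vec4 0 1 0 0" "?t n1 = vec4 0 0 1 0" "?t n2 = vec4 0 0 0 1"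
    using inj M by (metis injD)+
  then show ?thesis
    by (auto simp: mink_frame_def vec_eq_iff forall_4)
qed

lemma pseudo_orthonormal_frame_imp_mink_frame:
  "pseudo_orthonormal_frame x y n1 n2 \<Longrightarrow> mink_frame x y n1 n2"
  by (simp add: pseudo_orthonormal_frame_def mink_frame_def)

text \<open>The product rule for a constant product; it makes the derivative coefficients of a frame
  skew with respect to \<open>mink\<close>.\<close>

lemma pd_mink_const:
  assumes U: "open U" "p \<in> U" and sm: "smooth2_on U v" "smooth2_on U w"
    and const: "\<And>q. q \<in> U \<Longrightarrow> mink (v q) (w q) = c"
  shows "mink (v p) (pd_u w p) = - mink (pd_u v p) (w p)" "mink (v p) (pd_v w p) = - mink (pd_v v p) (w p)"
proof -
  have d: "v differentiable (at p)" "w differentiable (at p)"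
    using sm U smooth2_on_differentiable by blast+
  have "pd_u (\<lambda>q. mink (v q) (w q)) p = pd_u (\<lambda>q. c) p" "pd_v (\<lambda>q. mink (v q) (w q)) p = pd_v (\<lambda>q. c) p"
    by (rule pd_cong[OF U const]; simp)+
  moreover have "pd_u (\<lambda>q. c) p = 0" "pd_v (\<lambda>q. c) p = 0"
    using pd_eqI[of "\<lambda>q. c" "\<lambda>h. 0" p] by simp_all
  ultimately show "mink (v p) (pd_u w p) = - mink (pd_u v p) (w p)" "mink (v p) (pd_v w p) = - mink (pd_v v p) (w p)"
    using mink.pd[OF d] by auto
qed

subsection \<open>The frame equations as a linear system\<close>

type_synonym state = "(real ^ 4) \<times> (real ^ 4) \<times> (real ^ 4) \<times> (real ^ 4) \<times> (real ^ 4)"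

text \<open>The Gauss and Weingarten formulas in the direction u, to be used with
  \<open>a = f_u / f\<close>, \<open>l = f * lam1\<close>, \<open>m = f * \<mu>1\<close>,
  \<open>k = f * \<nu>\<close> and the normal connection \<open>b\<close>. Up to \<open>b\<close>,
  constancy of the frame products forces the rows of \<open>n1\<close> and \<open>n2\<close> from
  those of \<open>x\<close> and \<open>y\<close>.\<close>

definition frame_u :: "real \<Rightarrow> real \<Rightarrow> real \<Rightarrow> real \<Rightarrow> real \<Rightarrow> real \<Rightarrow> state \<Rightarrow> state" where
  "frame_u f a l m k b = (\<lambda>(z, x, y, n1, n2).
     (f *\<^sub>R x,
      a *\<^sub>R x + l *\<^sub>R n1 + m *\<^sub>R n2,
      - a *\<^sub>R y - k *\<^sub>R n1,
      - k *\<^sub>R x + l *\<^sub>R y + b *\<^sub>R n2,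
      m *\<^sub>R y - b *\<^sub>R n1))"

text \<open>This is \<open>frame_u\<close> with the roles of \<open>x\<close> and \<open>y\<close>
  exchanged.\<close>

definition frame_v :: "real \<Rightarrow> real \<Rightarrow> real \<Rightarrow> real \<Rightarrow> real \<Rightarrow> real \<Rightarrow> state \<Rightarrow> state" where
  "frame_v f c l m k b = (\<lambda>(z, x, y, n1, n2).
     (f *\<^sub>R y,
      - c *\<^sub>R x - k *\<^sub>R n1,
      c *\<^sub>R y + l *\<^sub>R n1 + m *\<^sub>R n2,
      l *\<^sub>R x - k *\<^sub>R y + b *\<^sub>R n2,
      m *\<^sub>R x - b *\<^sub>R n1))"

lemma bounded_linear_frame: "bounded_linear (frame_u f a l m k b)" "bounded_linear (frame_v f a l m k b)"
  unfolding linear_conv_bounded_linear[symmetric]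
  by (auto intro!: linearI simp: frame_u_def frame_v_def algebra_simps)

text \<open>The operator is linear in its six coefficients. As a combination of six fixed operators
  it inherits smoothness and partial derivatives from them.\<close>

definition frame_U :: "real \<Rightarrow> real \<Rightarrow> real \<Rightarrow> real \<Rightarrow> real \<Rightarrow> real \<Rightarrow> state \<Rightarrow>\<^sub>L state" where
  "frame_U f a l m k b =
     f *\<^sub>R Blinfun (frame_u 1 0 0 0 0 0) + a *\<^sub>R Blinfun (frame_u 0 1 0 0 0 0) +
     l *\<^sub>R Blinfun (frame_u 0 0 1 0 0 0) + m *\<^sub>R Blinfun (frame_u 0 0 0 1 0 0) +
     k *\<^sub>R Blinfun (frame_u 0 0 0 0 1 0) + b *\<^sub>R Blinfun (frame_u 0 0 0 0 0 1)"

definition frame_V :: "real \<Rightarrow> real \<Rightarrow> real \<Rightarrow> real \<Rightarrow> real \<Rightarrow> real \<Rightarrow> state \<Rightarrow>\<^sub>L state" where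
  "frame_V f c l m k b =
     f *\<^sub>R Blinfun (frame_v 1 0 0 0 0 0) + c *\<^sub>R Blinfun (frame_v 0 1 0 0 0 0) +
     l *\<^sub>R Blinfun (frame_v 0 0 1 0 0 0) + m *\<^sub>R Blinfun (frame_v 0 0 0 1 0 0) +
     k *\<^sub>R Blinfun (frame_v 0 0 0 0 1 0) + b *\<^sub>R Blinfun (frame_v 0 0 0 0 0 1)"

lemma frame_apply:
  "blinfun_apply (frame_U f a l m k b) w = frame_u f a l m k b w"
  "blinfun_apply (frame_V f a l m k b) w = frame_v f a l m k b w"
  by (cases w; simp add: frame_U_def frame_V_def blinfun.add_left blinfun.scaleR_left
      bounded_linear_Blinfun_apply bounded_linear_frame; simp add: frame_u_def frame_v_def)+

lemma smooth2_on_frame: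
  assumes "open S" "smooth2_on S f" "smooth2_on S a" "smooth2_on S l" "smooth2_on S m"
    "smooth2_on S k" "smooth2_on S b"
  shows "smooth2_on S (\<lambda>p. frame_U (f p) (a p) (l p) (m p) (k p) (b p))"
    "smooth2_on S (\<lambda>p. frame_V (f p) (a p) (l p) (m p) (k p) (b p))"
  unfolding frame_U_def frame_V_def
  by (intro smooth2_on_add smooth2_on_scaleR smooth2_on_const assms)+

lemma pd_frame:
  assumes "f differentiable (at p)" "a differentiable (at p)" "l differentiable (at p)"
    "m differentiable (at p)" "k differentiable (at p)" "b differentiable (at p)"
  shows "pd_v (\<lambda>p. frame_U (f p) (a p) (l p) (m p) (k p) (b p)) p =
      frame_U (pd_v f p) (pd_v a p) (pd_v l p) (pd_v m p) (pd_v k p) (pd_v b p)"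
    "pd_u (\<lambda>p. frame_V (f p) (a p) (l p) (m p) (k p) (b p)) p =
      frame_V (pd_u f p) (pd_u a p) (pd_u l p) (pd_u m p) (pd_u k p) (pd_u b p)"
proof -
  have "((\<lambda>p. frame_U (f p) (a p) (l p) (m p) (k p) (b p)) has_derivative
    (\<lambda>h. frame_U (fst h *\<^sub>R pd_u f p + snd h *\<^sub>R pd_v f p) (fst h *\<^sub>R pd_u a p + snd h *\<^sub>R pd_v a p)
      (fst h *\<^sub>R pd_u l p + snd h *\<^sub>R pd_v l p) (fst h *\<^sub>R pd_u m p + snd h *\<^sub>R pd_v m p)
      (fst h *\<^sub>R pd_u k p + snd h *\<^sub>R pd_v k p) (fst h *\<^sub>R pd_u b p + snd h *\<^sub>R pd_v b p))) (at p)"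
    unfolding frame_U_def
    by (intro has_derivative_add bounded_linear.has_derivative[OF bounded_linear_scaleR_left]
        has_derivative_pd assms)
  from pd_eqI(2)[OF this] show "pd_v (\<lambda>p. frame_U (f p) (a p) (l p) (m p) (k p) (b p)) p =
      frame_U (pd_v f p) (pd_v a p) (pd_v l p) (pd_v m p) (pd_v k p) (pd_v b p)" by simp
  have "((\<lambda>p. frame_V (f p) (a p) (l p) (m p) (k p) (b p)) has_derivative
    (\<lambda>h. frame_V (fst h *\<^sub>R pd_u f p + snd h *\<^sub>R pd_v f p) (fst h *\<^sub>R pd_u a p + snd h *\<^sub>R pd_v a p)
      (fst h *\<^sub>R pd_u l p + snd h *\<^sub>R pd_v l p) (fst h *\<^sub>R pd_u m p + snd h *\<^sub>R pd_v m p)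
      (fst h *\<^sub>R pd_u k p + snd h *\<^sub>R pd_v k p) (fst h *\<^sub>R pd_u b p + snd h *\<^sub>R pd_v b p))) (at p)"
    unfolding frame_V_def
    by (intro has_derivative_add bounded_linear.has_derivative[OF bounded_linear_scaleR_left]
        has_derivative_pd assms)
  from pd_eqI(1)[OF this] show "pd_u (\<lambda>p. frame_V (f p) (a p) (l p) (m p) (k p) (b p)) p =
      frame_V (pd_u f p) (pd_u a p) (pd_u l p) (pd_u m p) (pd_u k p) (pd_u b p)" by simp
qed

text \<open>Each hypothesis is what some coordinate of the equality of mixed derivatives demands.
  The row of \<open>z\<close> ties \<open>a\<close> and \<open>c\<close> to \<open>f\<close>; then
  come the Gauss equation, the four Codazzi equations solved for one derivative each, and the Ricci
  equation.\<close>

lemma frame_compatible: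
  assumes "fu = f * a" "fv = f * c"
    and "av + cu + l1 * l2 + m1 * m2 = k\<^sup>2"
    and "l1v = m1 * b2 + a * k - c * l1 - ku" "m1v = - c * m1 - k * b1 - l1 * b2"
    and "l2u = m2 * b1 + c * k - a * l2 - kv" "m2u = - a * m2 - k * b2 - l2 * b1"
    and "b1v - b2u + l1 * m2 - l2 * m1 = 0"
  shows "frame_U fv av l1v m1v kv b1v + (frame_U f a l1 m1 k b1 o\<^sub>L frame_V f c l2 m2 k b2)
    = frame_V fu cu l2u m2u ku b2u + (frame_V f c l2 m2 k b2 o\<^sub>L frame_U f a l1 m1 k b1)"
proof (rule blinfun_eqI)
  fix w :: state
  obtain z x y n1 n2 where w: "w = (z, x, y, n1, n2)" by (cases w)
  have eqs: "av = k\<^sup>2 - cu - l1 * l2 - m1 * m2" "b1v = b2u - l1 * m2 + l2 * m1"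
    using assms(3,8) by auto
  show "(frame_U fv av l1v m1v kv b1v + (frame_U f a l1 m1 k b1 o\<^sub>L frame_V f c l2 m2 k b2)) w
    = (frame_V fu cu l2u m2u ku b2u + (frame_V f c l2 m2 k b2 o\<^sub>L frame_U f a l1 m1 k b1)) w"
    unfolding blinfun.add_left blinfun_apply_blinfun_compose frame_apply w
      frame_u_def frame_v_def prod.case add_Pair prod.inject eqs assms(1,2,4-7)
    by (intro conjI; simp add: vec_eq_iff; simp add: algebra_simps power2_eq_square)
qed

lemma bounded_linear_Pair_0: "bounded_linear (\<lambda>a. (a, 0))" "bounded_linear (\<lambda>b. (0, b))"
  by (auto intro!: bounded_linear_Pair bounded_linear_ident bounded_linear_zero)

lemma smooth2_on_Pair:
  assumes "open S" "smooth2_on S g" "smooth2_on S h"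
  shows "smooth2_on S (\<lambda>p. (g p, h p))"
  using smooth2_on_add[OF assms(1) bounded_linear.smooth2_on[OF bounded_linear_Pair_0(1) assms(1,2)]
      bounded_linear.smooth2_on[OF bounded_linear_Pair_0(2) assms(1,3)]]
  by simp

lemma pd_Pair:
  assumes "g differentiable (at p)" "h differentiable (at p)"
  shows "pd_u (\<lambda>p. (g p, h p)) p = (pd_u g p, pd_u h p)" "pd_v (\<lambda>p. (g p, h p)) p = (pd_v g p, pd_v h p)"
  using pd_eqI[OF has_derivative_Pair[OF has_derivative_pd[OF assms(1)] has_derivative_pd[OF assms(2)]]]
  by simp_all

subsection \<open>The second fundamental form in isotropic parameters\<close>

text \<open>The algebra at a single point, with \<open>F\<close> the value of \<open>f\<close>
  there. It is used in both directions: for the surface built from the system and for an arbitrary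
  surface with the prescribed data.\<close>

locale isotropic_point =
  fixes z :: surface and p :: "real \<times> real" and F :: real and x y n1 n2 :: "real ^ 4"
  assumes F: "F > 0" and pd_z: "pd_u z p = F *\<^sub>R x" "pd_v z p = F *\<^sub>R y"
    and frame: "mink_frame x y n1 n2"
begin

lemmas fr = mink_frameD[OF frame]

lemma tangent_coords_unique:
  assumes "s1 *\<^sub>R x + t1 *\<^sub>R y = s2 *\<^sub>R x + t2 *\<^sub>R y"
  shows "s1 = s2 \<and> t1 = t2"
  using arg_cong[OF assms, of "\<lambda>w. mink w x"] arg_cong[OF assms, of "\<lambda>w. mink w y"]
  by (simp add: mink_linear fr)

lemma tangent_plane_iff: "w \<in> tangent_plane z p \<longleftrightarrow> (\<exists>s t. w = s *\<^sub>R x + t *\<^sub>R y)"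
proof
  assume "w \<in> tangent_plane z p"
  then obtain s t where "w = s *\<^sub>R pd_u z p + t *\<^sub>R pd_v z p"
    unfolding tangent_plane_def span_insert span_empty by (auto simp: algebra_simps)
  then show "\<exists>s t. w = s *\<^sub>R x + t *\<^sub>R y" unfolding pd_z by auto
next
  assume "\<exists>s t. w = s *\<^sub>R x + t *\<^sub>R y"
  then obtain s t where "w = (s / F) *\<^sub>R pd_u z p + (t / F) *\<^sub>R pd_v z p"
    using F by (auto simp: pd_z)
  then show "w \<in> tangent_plane z p"
    unfolding tangent_plane_def
    by (metis insertCI span_add span_base span_scale)
qed

lemma tangent_planeI: "s *\<^sub>R x + t *\<^sub>R y \<in> tangent_plane z p"
  unfolding tangent_plane_iff by blast

lemma normal_plane_iff: "w \<in> normal_plane z p \<longleftrightarrow> mink w x = 0 \<and> mink w y = 0"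
proof -
  have "x \<in> tangent_plane z p" "y \<in> tangent_plane z p"
    using tangent_planeI[of 1 0] tangent_planeI[of 0 1] by simp_all
  then show ?thesis
    by (auto simp: normal_plane_def tangent_plane_iff mink_linear)
qed

text \<open>By \<open>mink_frame_expand\<close>, what remains of \<open>w\<close> after its
  \<open>n1\<close> and \<open>n2\<close> terms is tangent. Pairing with \<open>n1\<close> and
  \<open>n2\<close> shows that no other normal vector does this.\<close>

lemma normal_part_eq: "normal_part z p w = mink w n1 *\<^sub>R n1 + mink w n2 *\<^sub>R n2"
  unfolding normal_part_def
proof (rule the_equality)
  have "w - (mink w n1 *\<^sub>R n1 + mink w n2 *\<^sub>R n2) = (- mink w y) *\<^sub>R x + (- mink w x) *\<^sub>R y"
    using mink_frame_expand[OF frame, of w] by (simp add: algebra_simps)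
  then have "w - (mink w n1 *\<^sub>R n1 + mink w n2 *\<^sub>R n2) \<in> tangent_plane z p"
    by (simp only: tangent_planeI)
  then show "mink w n1 *\<^sub>R n1 + mink w n2 *\<^sub>R n2 \<in> normal_plane z p \<and>
      w - (mink w n1 *\<^sub>R n1 + mink w n2 *\<^sub>R n2) \<in> tangent_plane z p"
    by (simp add: normal_plane_iff mink_linear fr)
next
  fix n assume n: "n \<in> normal_plane z p \<and> w - n \<in> tangent_plane z p"
  then obtain s t where st: "w - n = s *\<^sub>R x + t *\<^sub>R y" by (auto simp: tangent_plane_iff)
  then have "mink (w - n) n1 = 0" "mink (w - n) n2 = 0" by (simp_all add: mink_linear fr)
  then have "mink n n1 = mink w n1" "mink n n2 = mink w n2" by (simp_all add: mink_linear)
  with n mink_frame_expand[OF frame, of n] show "n = mink w n1 *\<^sub>R n1 + mink w n2 *\<^sub>R n2"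
    by (simp add: normal_plane_iff)
qed

lemma tangent_coords_eq: "tangent_coords z p (s *\<^sub>R x + t *\<^sub>R y) = (s / F, t / F)"
  unfolding tangent_coords_def
proof (rule the_equality)
  show "s *\<^sub>R x + t *\<^sub>R y = fst (s / F, t / F) *\<^sub>R pd_u z p + snd (s / F, t / F) *\<^sub>R pd_v z p"
    using F by (simp add: pd_z)
next
  fix c assume "s *\<^sub>R x + t *\<^sub>R y = fst c *\<^sub>R pd_u z p + snd c *\<^sub>R pd_v z p"
  then have "s = fst c * F \<and> t = snd c * F"
    unfolding pd_z scaleR_scaleR by (rule tangent_coords_unique)
  with F show "c = (s / F, t / F)" by (auto simp: prod_eq_iff)
qed

lemma second_fundamental_eq:
  "second_fundamental z p (s1 *\<^sub>R x + t1 *\<^sub>R y) (s2 *\<^sub>R x + t2 *\<^sub>R y) =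
    normal_part z p ((1 / F\<^sup>2) *\<^sub>R
      ((s1 * s2) *\<^sub>R pd_u (pd_u z) p + (s1 * t2) *\<^sub>R pd_u (pd_v z) p +
       (t1 * s2) *\<^sub>R pd_v (pd_u z) p + (t1 * t2) *\<^sub>R pd_v (pd_v z) p))"
  unfolding second_fundamental_def tangent_coords_eq
  by (simp add: algebra_simps power2_eq_square)

lemma second_fundamental_frame:
  "second_fundamental z p x x = normal_part z p ((1 / F\<^sup>2) *\<^sub>R pd_u (pd_u z) p)"
  "second_fundamental z p x y = normal_part z p ((1 / F\<^sup>2) *\<^sub>R pd_u (pd_v z) p)"
  "second_fundamental z p y y = normal_part z p ((1 / F\<^sup>2) *\<^sub>R pd_v (pd_v z) p)"
  using second_fundamental_eq[of 1 0 1 0] second_fundamental_eq[of 1 0 0 1]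
    second_fundamental_eq[of 0 1 0 1] by simp_all

text \<open>In isotropic parameters \<open>E = G = 0\<close>, so only the two mixed terms of the
  trace survive, and the assumption makes them equal. With \<open>mink z_u z_v = - F^2\<close> the
  factors of \<open>F\<close> cancel and the sign remains.\<close>

lemma mean_curvature_vector_eq:
  assumes "pd_v (pd_u z) p = pd_u (pd_v z) p"
  shows "mean_curvature_vector z p = - second_fundamental z p x y"
proof -
  have "second_fundamental z p (F *\<^sub>R x) (F *\<^sub>R y) = normal_part z p (pd_u (pd_v z) p)"
    "second_fundamental z p (F *\<^sub>R y) (F *\<^sub>R x) = normal_part z p (pd_u (pd_v z) p)"
    using second_fundamental_eq[of F 0 0 F] second_fundamental_eq[of 0 F F 0] assms F
    by (simp_all add: power2_eq_square)
  moreover have "mink (F *\<^sub>R x) (F *\<^sub>R x) = 0" "mink (F *\<^sub>R y) (F *\<^sub>R y) = 0"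
    "mink (F *\<^sub>R x) (F *\<^sub>R y) = - F\<^sup>2"
    by (simp_all add: mink_linear fr power2_eq_square)
  moreover have "normal_part z p ((1 / F\<^sup>2) *\<^sub>R w) = (1 / F\<^sup>2) *\<^sub>R normal_part z p w" for w
    by (simp add: normal_part_eq mink_linear algebra_simps)
  ultimately show ?thesis
    unfolding mean_curvature_vector_def pd_z Let_def second_fundamental_frame(2)
    using F by (simp add: scaleR_add_left[symmetric] power2_eq_square field_simps)
qed

lemma immersed: "pd_u z p \<noteq> pd_v z p" "independent {pd_u z p, pd_v z p}"
proof -
  show ne: "pd_u z p \<noteq> pd_v z p"
    using tangent_coords_unique[of F 0 0 F] F by (auto simp: pd_z)
  have "pd_v z p \<noteq> 0"
    using tangent_coords_unique[of 0 F 0 0] F by (auto simp: pd_z)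
  moreover have "pd_u z p \<noteq> k *\<^sub>R pd_v z p" for k
    using tangent_coords_unique[of F 0 0 "k * F"] F by (auto simp: pd_z)
  ultimately show "independent {pd_u z p, pd_v z p}"
    using ne by (auto simp: independent_insert span_singleton)
qed

lemma timelike:
  "\<exists>t\<in>tangent_plane z p. mink t t > 0" "\<exists>t\<in>tangent_plane z p. mink t t < 0"
proof -
  \<comment> \<open>The vectors \<open>x - y\<close> and \<open>x + y\<close> have squares 2 and
    -2.\<close>
  have "1 *\<^sub>R x + (- 1) *\<^sub>R y \<in> tangent_plane z p" "1 *\<^sub>R x + 1 *\<^sub>R y \<in> tangent_plane z p"
    by (rule tangent_planeI)+
  moreover have "mink (1 *\<^sub>R x + (- 1) *\<^sub>R y) (1 *\<^sub>R x + (- 1) *\<^sub>R y) > 0"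
    "mink (1 *\<^sub>R x + 1 *\<^sub>R y) (1 *\<^sub>R x + 1 *\<^sub>R y) < 0"
    by (simp_all add: mink_linear fr)
  ultimately show "\<exists>t\<in>tangent_plane z p. mink t t > 0" "\<exists>t\<in>tangent_plane z p. mink t t < 0"
    by blast+
qed

lemma isotropic:
  "mink (pd_u z p) (pd_u z p) = 0" "mink (pd_v z p) (pd_v z p) = 0"
  "mink (pd_u z p) (pd_v z p) = - F\<^sup>2"
  by (simp_all add: pd_z mink_linear fr power2_eq_square)

end

subsection \<open>The moving frame of the prescribed functions\<close>

locale prescribed_functions =
  fixes D :: "(real \<times> real) set"
    and f \<nu> lam1 \<mu>1 lam2 \<mu>2 :: "real \<times> real \<Rightarrow> real"
  assumes D: "open D"
    and smooth: "smooth2_on D f" "smooth2_on D \<nu>" "smooth2_on D lam1" "smooth2_on D \<mu>1"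
      "smooth2_on D lam2" "smooth2_on D \<mu>2"
    and f_pos: "\<And>p. p \<in> D \<Longrightarrow> f p > 0"
    and nu_pos: "\<And>p. p \<in> D \<Longrightarrow> \<nu> p > 0"
    and mu_nz: "\<And>p. p \<in> D \<Longrightarrow> \<mu>1 p * \<mu>2 p \<noteq> 0"
    and i: "\<And>p. p \<in> D \<Longrightarrow>
      pd_u (\<lambda>q. (lam2 q)\<^sup>2 + (\<mu>2 q)\<^sup>2) p
      + pd_u (\<lambda>q. ln (f q ^ 4)) p * ((lam2 p)\<^sup>2 + (\<mu>2 p)\<^sup>2)
      + 2 * lam2 p * pd_v \<nu> p
      + 2 * \<nu> p * \<mu>2 p / \<mu>1 p * (pd_u \<nu> p + pd_v lam1 p + lam1 p * pd_v (\<lambda>q. ln ((f q)\<^sup>2)) p) = 0"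
    and ii: "\<And>p. p \<in> D \<Longrightarrow>
      pd_v (\<lambda>q. (lam1 q)\<^sup>2 + (\<mu>1 q)\<^sup>2) p
      + pd_v (\<lambda>q. ln (f q ^ 4)) p * ((lam1 p)\<^sup>2 + (\<mu>1 p)\<^sup>2)
      + 2 * lam1 p * pd_u \<nu> p
      + 2 * \<nu> p * \<mu>1 p / \<mu>2 p * (pd_u lam2 p + pd_v \<nu> p + lam2 p * pd_u (\<lambda>q. ln ((f q)\<^sup>2)) p) = 0"
    and iii: "\<And>p. p \<in> D \<Longrightarrow>
      (2 * f p * pd_v (pd_u f) p - 2 * pd_u f p * pd_v f p) / f p ^ 4
      + lam1 p * lam2 p + \<mu>1 p * \<mu>2 p - (\<nu> p)\<^sup>2 = 0"
    and iv: "\<And>p. p \<in> D \<Longrightarrow>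
      (\<mu>1 p * lam2 p - \<mu>2 p * lam1 p)
        * ((f p)\<^sup>2 * \<mu>1 p * \<mu>2 p - pd_v (pd_u (\<lambda>q. ln ((f q)\<^sup>2))) p)
      + pd_u (pd_u \<nu>) p * \<mu>2 p - pd_v (pd_v \<nu>) p * \<mu>1 p
      + pd_v (pd_u lam1) p * \<mu>2 p - pd_v (pd_u lam2) p * \<mu>1 p
      + \<mu>2 p * pd_u lam1 p * pd_v (\<lambda>q. ln ((f q)\<^sup>2)) p
      - \<mu>1 p * pd_v lam2 p * pd_u (\<lambda>q. ln ((f q)\<^sup>2)) p
      - \<mu>2 p * pd_u \<mu>1 p / \<mu>1 p
        * (pd_u \<nu> p + pd_v lam1 p + lam1 p * pd_v (\<lambda>q. ln ((f q)\<^sup>2)) p)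
      + \<mu>1 p * pd_v \<mu>2 p / \<mu>2 p
        * (pd_u lam2 p + pd_v \<nu> p + lam2 p * pd_u (\<lambda>q. ln ((f q)\<^sup>2)) p) = 0"
begin

section \<open>Coefficients of the system and its integrability\<close>

definition a where "a = (\<lambda>p. pd_u f p / f p)"
definition c where "c = (\<lambda>p. pd_v f p / f p)"
definition l1 where "l1 = (\<lambda>p. f p * lam1 p)"
definition l2 where "l2 = (\<lambda>p. f p * lam2 p)"
definition m1 where "m1 = (\<lambda>p. f p * \<mu>1 p)"
definition m2 where "m2 = (\<lambda>p. f p * \<mu>2 p)"
definition k where "k = (\<lambda>p. f p * \<nu> p)"
text \<open>Since \<open>(ln f^2)_u = 2 * a\<close> and \<open>(ln f^2)_v = 2 * c\<close>, the
  functions \<open>N1\<close> and \<open>N2\<close> are the two brackets occurring in conditions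
  (i), (ii) and (iv).\<close>

definition N1 where "N1 = (\<lambda>p. pd_u lam2 p + (pd_v \<nu> p + lam2 p * (2 * a p)))"
definition N2 where "N2 = (\<lambda>p. pd_v lam1 p + (pd_u \<nu> p + lam1 p * (2 * c p)))"
text \<open>\<open>b1\<close> and \<open>b2\<close> are the candidates for the
  \<open>n2\<close>-components of the u- and v-derivative of \<open>n1\<close>; the
  \<open>n1\<close>-components of the Codazzi equations demand \<open>\<mu>2 * b1 = N1\<close> and
  \<open>\<mu>1 * b2 = N2\<close>.\<close>

definition b1 where "b1 = (\<lambda>p. N1 p / \<mu>2 p)"
definition b2 where "b2 = (\<lambda>p. N2 p / \<mu>1 p)"

lemma mu_nonzero: "p \<in> D \<Longrightarrow> \<mu>1 p \<noteq> 0" "p \<in> D \<Longrightarrow> \<mu>2 p \<noteq> 0" "p \<in> D \<Longrightarrow> f p \<noteq> 0"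
  using mu_nz f_pos by fastforce+

lemmas smooth_pd = smooth2_on_pd[OF D smooth(1)] smooth2_on_pd[OF D smooth(2)]
  smooth2_on_pd[OF D smooth(3)] smooth2_on_pd[OF D smooth(5)]

lemma smooth_coeffs: "smooth2_on D a" "smooth2_on D c" "smooth2_on D l1" "smooth2_on D l2"
  "smooth2_on D m1" "smooth2_on D m2" "smooth2_on D k" "smooth2_on D N1" "smooth2_on D N2"
  "smooth2_on D b1" "smooth2_on D b2"
proof -
  show ac: "smooth2_on D a" "smooth2_on D c"
    unfolding a_def c_def by (rule smooth2_on_divide[OF D _ smooth(1) mu_nonzero(3)] smooth_pd | assumption)+
  show "smooth2_on D l1" "smooth2_on D l2" "smooth2_on D m1" "smooth2_on D m2" "smooth2_on D k"
    unfolding l1_def l2_def m1_def m2_def k_def by (rule smooth2_on_mult[OF D] smooth)+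
  show N: "smooth2_on D N1" "smooth2_on D N2"
    unfolding N1_def N2_def
    by (rule smooth2_on_add[OF D] smooth2_on_mult[OF D] smooth2_on_const[OF D] smooth smooth_pd ac)+
  show "smooth2_on D b1" "smooth2_on D b2"
    unfolding b1_def b2_def
    by (rule smooth2_on_divide[OF D N(1) smooth(6) mu_nonzero(2)]
        smooth2_on_divide[OF D N(2) smooth(4) mu_nonzero(1)] | assumption)+
qed

lemma diff:
  assumes "p \<in> D"
  shows "f differentiable (at p)" "\<nu> differentiable (at p)" "lam1 differentiable (at p)"
    "\<mu>1 differentiable (at p)" "lam2 differentiable (at p)" "\<mu>2 differentiable (at p)"
    "pd_u f differentiable (at p)" "pd_v f differentiable (at p)"
    "pd_u \<nu> differentiable (at p)" "pd_v \<nu> differentiable (at p)"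
    "pd_v lam1 differentiable (at p)" "pd_u lam2 differentiable (at p)"
    "a differentiable (at p)" "c differentiable (at p)" "l1 differentiable (at p)"
    "l2 differentiable (at p)" "m1 differentiable (at p)" "m2 differentiable (at p)"
    "k differentiable (at p)" "N1 differentiable (at p)" "N2 differentiable (at p)"
    "b1 differentiable (at p)" "b2 differentiable (at p)"
  using smooth smooth_pd smooth_coeffs smooth2_on_differentiable[OF _ assms] by blast+

text \<open>All mixed second derivatives are brought to the order \<open>pd_v (pd_u _)\<close> of
  conditions (iii) and (iv). In particular \<open>pd_u c\<close> and \<open>pd_v a\<close> get the
  same expression, both being the mixed derivative of \<open>ln f\<close>.\<close>

lemma pd_coeffs:
  assumes p: "p \<in> D"
  shows "pd_u l2 p = pd_u f p * lam2 p + f p * pd_u lam2 p"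
    "pd_v l1 p = pd_v f p * lam1 p + f p * pd_v lam1 p"
    "pd_u m2 p = pd_u f p * \<mu>2 p + f p * pd_u \<mu>2 p"
    "pd_v m1 p = pd_v f p * \<mu>1 p + f p * pd_v \<mu>1 p"
    "pd_u k p = pd_u f p * \<nu> p + f p * pd_u \<nu> p"
    "pd_v k p = pd_v f p * \<nu> p + f p * pd_v \<nu> p"
    "pd_v a p = (pd_v (pd_u f) p * f p - pd_u f p * pd_v f p) / (f p)\<^sup>2"
    "pd_u c p = (pd_v (pd_u f) p * f p - pd_u f p * pd_v f p) / (f p)\<^sup>2"
    "pd_v N1 p = pd_v (pd_u lam2) p + pd_v (pd_v \<nu>) p + pd_v lam2 p * (2 * a p) + lam2 p * (2 * pd_v a p)"
    "pd_u N2 p = pd_v (pd_u lam1) p + pd_u (pd_u \<nu>) p + pd_u lam1 p * (2 * c p) + lam1 p * (2 * pd_v a p)"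
    "pd_v b1 p = (pd_v N1 p * \<mu>2 p - N1 p * pd_v \<mu>2 p) / (\<mu>2 p)\<^sup>2"
    "pd_u b2 p = (pd_u N2 p * \<mu>1 p - N2 p * pd_u \<mu>1 p) / (\<mu>1 p)\<^sup>2"
proof -
  note d = diff[OF p]
  have pd_const: "pd_u (\<lambda>q. 2::real) p = 0" "pd_v (\<lambda>q. 2::real) p = 0"
    using pd_eqI[of "\<lambda>q. 2::real" "\<lambda>h. 0" p] by simp_all
  show "pd_u l2 p = pd_u f p * lam2 p + f p * pd_u lam2 p"
    "pd_v l1 p = pd_v f p * lam1 p + f p * pd_v lam1 p"
    "pd_u m2 p = pd_u f p * \<mu>2 p + f p * pd_u \<mu>2 p"
    "pd_v m1 p = pd_v f p * \<mu>1 p + f p * pd_v \<mu>1 p"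
    "pd_u k p = pd_u f p * \<nu> p + f p * pd_u \<nu> p"
    "pd_v k p = pd_v f p * \<nu> p + f p * pd_v \<nu> p"
    unfolding l1_def l2_def m1_def m2_def k_def
    by (simp_all add: pd_mult d)
  show av: "pd_v a p = (pd_v (pd_u f) p * f p - pd_u f p * pd_v f p) / (f p)\<^sup>2"
    unfolding a_def by (rule pd_divide(2)[OF d(7,1) mu_nonzero(3)[OF p]])
  show cu: "pd_u c p = (pd_v (pd_u f) p * f p - pd_u f p * pd_v f p) / (f p)\<^sup>2"
    using pd_divide(1)[OF d(8,1) mu_nonzero(3)[OF p]]
    by (simp add: c_def pd_commute[OF D smooth(1) p] mult.commute)
  show "pd_v N1 p = pd_v (pd_u lam2) p + pd_v (pd_v \<nu>) p + pd_v lam2 p * (2 * a p) + lam2 p * (2 * pd_v a p)"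
    unfolding N1_def
    by (simp add: pd_add pd_mult d pd_const differentiable_add differentiable_mult)
  show "pd_u N2 p = pd_v (pd_u lam1) p + pd_u (pd_u \<nu>) p + pd_u lam1 p * (2 * c p) + lam1 p * (2 * pd_v a p)"
    unfolding N2_def av cu[symmetric]
    by (simp add: pd_add pd_mult d pd_const differentiable_add differentiable_mult pd_commute[OF D smooth(3) p])
  show "pd_v b1 p = (pd_v N1 p * \<mu>2 p - N1 p * pd_v \<mu>2 p) / (\<mu>2 p)\<^sup>2"
    unfolding b1_def by (rule pd_divide(2)[OF d(20,6) mu_nonzero(2)[OF p]])
  show "pd_u b2 p = (pd_u N2 p * \<mu>1 p - N2 p * pd_u \<mu>1 p) / (\<mu>1 p)\<^sup>2"
    unfolding b2_def by (rule pd_divide(1)[OF d(21,4) mu_nonzero(1)[OF p]])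
qed

lemma pd_ln:
  assumes p: "p \<in> D"
  shows "pd_u (\<lambda>q. ln ((f q)\<^sup>2)) p = 2 * a p" "pd_v (\<lambda>q. ln ((f q)\<^sup>2)) p = 2 * c p"
    "pd_u (\<lambda>q. ln (f q ^ 4)) p = 4 * a p" "pd_v (\<lambda>q. ln (f q ^ 4)) p = 4 * c p"
    "pd_v (pd_u (\<lambda>q. ln ((f q)\<^sup>2))) p = 2 * pd_v a p"
proof -
  have u: "pd_u (\<lambda>q. ln ((f q)\<^sup>2)) q = 2 * a q" if "q \<in> D" for q
    using pd_ln_power(1)[OF diff(1)[OF that] f_pos[OF that], of 2] by (simp add: a_def)
  then show "pd_u (\<lambda>q. ln ((f q)\<^sup>2)) p = 2 * a p" by (simp add: p)
  show "pd_v (\<lambda>q. ln ((f q)\<^sup>2)) p = 2 * c p"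
    "pd_u (\<lambda>q. ln (f q ^ 4)) p = 4 * a p" "pd_v (\<lambda>q. ln (f q ^ 4)) p = 4 * c p"
    using pd_ln_power[OF diff(1)[OF p] f_pos[OF p], of 2] pd_ln_power[OF diff(1)[OF p] f_pos[OF p], of 4]
    by (simp_all add: a_def c_def)
  have "pd_v (pd_u (\<lambda>q. ln ((f q)\<^sup>2))) p = pd_v (\<lambda>q. 2 * a q) p"
    by (rule pd_cong(2)[OF D p u]) (auto intro!: diff(13)[OF p])
  also have "\<dots> = 2 * pd_v a p"
    by (rule bounded_linear.pd(2)[OF bounded_linear_mult_right diff(13)[OF p]])
  finally show "pd_v (pd_u (\<lambda>q. ln ((f q)\<^sup>2))) p = 2 * pd_v a p" .
qed

text \<open>The Gauss equation is (iii) times \<open>f^2\<close>. The equations for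
  \<open>l1\<close> and \<open>l2\<close> hold by the choice of \<open>b2\<close> and
  \<open>b1\<close>. The equation for \<open>m1\<close> is (ii) after multiplication by
  \<open>2 * \<mu>1\<close>, that for \<open>m2\<close> is (i) after multiplication by
  \<open>2 * \<mu>2\<close>, each up to a factor \<open>f\<close>. The last one is (iv) after
  multiplication by \<open>- \<mu>1 * \<mu>2\<close>.\<close>

lemma compatibility:
  assumes p: "p \<in> D"
  shows "pd_u f p = f p * a p" "pd_v f p = f p * c p"
    "pd_v a p + pd_u c p + l1 p * l2 p + m1 p * m2 p = (k p)\<^sup>2"
    "pd_v l1 p = m1 p * b2 p + a p * k p - c p * l1 p - pd_u k p"
    "pd_v m1 p = - c p * m1 p - k p * b1 p - l1 p * b2 p"
    "pd_u l2 p = m2 p * b1 p + c p * k p - a p * l2 p - pd_v k p"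
    "pd_u m2 p = - a p * m2 p - k p * b2 p - l2 p * b1 p"
    "pd_v b1 p - pd_u b2 p + l1 p * m2 p - l2 p * m1 p = 0"
proof -
  note nz = mu_nonzero[OF p]
  note pc = pd_coeffs[OF p] and d = diff[OF p]
  show fu: "pd_u f p = f p * a p" and fv: "pd_v f p = f p * c p"
    using nz by (simp_all add: a_def c_def)
  have "pd_v a p + pd_u c p = (f p)\<^sup>2 * ((2 * f p * pd_v (pd_u f) p - 2 * pd_u f p * pd_v f p) / f p ^ 4)"
    unfolding pc using nz by (simp add: field_simps power2_eq_square eval_nat_numeral)
  also have "(2 * f p * pd_v (pd_u f) p - 2 * pd_u f p * pd_v f p) / f p ^ 4
      = (\<nu> p)\<^sup>2 - lam1 p * lam2 p - \<mu>1 p * \<mu>2 p"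
    using iii[OF p] by simp
  finally show "pd_v a p + pd_u c p + l1 p * l2 p + m1 p * m2 p = (k p)\<^sup>2"
    by (simp add: l1_def l2_def m1_def m2_def k_def algebra_simps power2_eq_square)
  have mb: "m1 p * b2 p = f p * N2 p" "m2 p * b1 p = f p * N1 p"
    using nz by (simp_all add: m1_def m2_def b1_def b2_def)
  show "pd_v l1 p = m1 p * b2 p + a p * k p - c p * l1 p - pd_u k p"
    "pd_u l2 p = m2 p * b1 p + c p * k p - a p * l2 p - pd_v k p"
    unfolding mb pc fu fv by (simp_all add: N1_def N2_def k_def l1_def l2_def algebra_simps)
  have sq: "pd_u (\<lambda>q. (lam2 q)\<^sup>2 + (\<mu>2 q)\<^sup>2) p = 2 * lam2 p * pd_u lam2 p + 2 * \<mu>2 p * pd_u \<mu>2 p"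
    "pd_v (\<lambda>q. (lam1 q)\<^sup>2 + (\<mu>1 q)\<^sup>2) p = 2 * lam1 p * pd_v lam1 p + 2 * \<mu>1 p * pd_v \<mu>1 p"
    unfolding power2_eq_square
    by (simp_all add: pd_add pd_mult d differentiable_mult)
  have N: "pd_u \<nu> p + pd_v lam1 p + lam1 p * (2 * c p) = N2 p" "pd_u lam2 p + pd_v \<nu> p + lam2 p * (2 * a p) = N1 p"
    by (simp_all add: N1_def N2_def)
  have bN: "N1 p = \<mu>2 p * b1 p" "N2 p = \<mu>1 p * b2 p"
    using nz by (simp_all add: b1_def b2_def)
  have "2 * \<mu>1 p * (pd_v m1 p + c p * m1 p + k p * b1 p + l1 p * b2 p) =
      f p * (2 * lam1 p * pd_v lam1 p + 2 * \<mu>1 p * pd_v \<mu>1 p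
        + 4 * c p * ((lam1 p)\<^sup>2 + (\<mu>1 p)\<^sup>2) + 2 * lam1 p * pd_u \<nu> p + 2 * \<nu> p * \<mu>1 p * b1 p)"
  proof -
    \<comment> \<open>Replacing \<open>\<mu>1 * b2\<close> by \<open>N2\<close> brings in the
      v-derivative of \<open>lam1\<close>, which completes the derivative of
      \<open>lam1^2 + \<mu>1^2\<close>.\<close>
    have "2 * \<mu>1 p * (l1 p * b2 p) = 2 * l1 p * N2 p" unfolding bN by simp
    then show ?thesis
      unfolding pc fv by (simp add: N2_def k_def l1_def m1_def algebra_simps power2_eq_square)
  qed
  also have "2 * \<nu> p * \<mu>1 p * b1 p = 2 * \<nu> p * \<mu>1 p / \<mu>2 p * N1 p"
    using nz by (simp add: b1_def)
  finally have "2 * \<mu>1 p * (pd_v m1 p + c p * m1 p + k p * b1 p + l1 p * b2 p) = 0"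
    using ii[OF p] unfolding sq pd_ln[OF p] N by simp
  then show "pd_v m1 p = - c p * m1 p - k p * b1 p - l1 p * b2 p"
    using nz by simp
  have "2 * \<mu>2 p * (pd_u m2 p + a p * m2 p + k p * b2 p + l2 p * b1 p) =
      f p * (2 * lam2 p * pd_u lam2 p + 2 * \<mu>2 p * pd_u \<mu>2 p
        + 4 * a p * ((lam2 p)\<^sup>2 + (\<mu>2 p)\<^sup>2) + 2 * lam2 p * pd_v \<nu> p + 2 * \<nu> p * \<mu>2 p * b2 p)"
  proof -
    have "2 * \<mu>2 p * (l2 p * b1 p) = 2 * l2 p * N1 p" unfolding bN by simp
    then show ?thesis
      unfolding pc fu by (simp add: N1_def k_def l2_def m2_def algebra_simps power2_eq_square)
  qed
  also have "2 * \<nu> p * \<mu>2 p * b2 p = 2 * \<nu> p * \<mu>2 p / \<mu>1 p * N2 p"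
    using nz by (simp add: b2_def)
  finally have "2 * \<mu>2 p * (pd_u m2 p + a p * m2 p + k p * b2 p + l2 p * b1 p) = 0"
    using i[OF p] unfolding sq pd_ln[OF p] N by simp
  then show "pd_u m2 p = - a p * m2 p - k p * b2 p - l2 p * b1 p"
    using nz by simp
  \<comment> \<open>The factor reduces the squared denominators of the quotient rule to the simple
    ones in (iv). The second derivatives of \<nu> there come from those of \<open>N1\<close> in v
    and of \<open>N2\<close> in u.\<close>
  have "- (\<mu>1 p * \<mu>2 p) * (pd_v b1 p - pd_u b2 p + l1 p * m2 p - l2 p * m1 p) =
      - \<mu>1 p * pd_v N1 p + \<mu>1 p * pd_v \<mu>2 p / \<mu>2 p * N1 p
      + \<mu>2 p * pd_u N2 p - \<mu>2 p * pd_u \<mu>1 p / \<mu>1 p * N2 p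
      + (f p)\<^sup>2 * \<mu>1 p * \<mu>2 p * (lam2 p * \<mu>1 p - lam1 p * \<mu>2 p)"
    unfolding pc(11,12) using nz
    by (simp add: l1_def l2_def m1_def m2_def field_simps power2_eq_square)
  also have "\<dots> = 0"
    using iv[OF p] unfolding pd_ln[OF p] N pc(9,10) by (simp add: algebra_simps)
  finally show "pd_v b1 p - pd_u b2 p + l1 p * m2 p - l2 p * m1 p = 0"
    using nz by simp
qed

section \<open>Moving frames and their surfaces\<close>

definition coeff_u where "coeff_u p = frame_U (f p) (a p) (l1 p) (m1 p) (k p) (b1 p)"
definition coeff_v where "coeff_v p = frame_V (f p) (c p) (l2 p) (m2 p) (k p) (b2 p)"

lemma smooth_coeff: "smooth2_on D coeff_u" "smooth2_on D coeff_v"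
  unfolding coeff_u_def[abs_def] coeff_v_def[abs_def]
  by (intro smooth2_on_frame D smooth smooth_coeffs)+

lemma coeff_compatible:
  assumes "p \<in> D"
  shows "pd_v coeff_u p + (coeff_u p o\<^sub>L coeff_v p) = pd_u coeff_v p + (coeff_v p o\<^sub>L coeff_u p)"
  unfolding coeff_u_def[abs_def] coeff_v_def[abs_def]
    pd_frame(1)[OF diff(1)[OF assms] diff(13)[OF assms] diff(15)[OF assms] diff(17)[OF assms]
      diff(19)[OF assms] diff(22)[OF assms]]
    pd_frame(2)[OF diff(1)[OF assms] diff(14)[OF assms] diff(16)[OF assms] diff(18)[OF assms]
      diff(19)[OF assms] diff(23)[OF assms]]
  by (rule frame_compatible) (use compatibility[OF assms] in \<open>simp_all add: algebra_simps\<close>)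

definition moving_frame :: "(real \<times> real) set \<Rightarrow> surface \<Rightarrow> surface \<Rightarrow> surface \<Rightarrow> surface \<Rightarrow> surface \<Rightarrow> bool" where
  "moving_frame U z x y n1 n2 \<longleftrightarrow>
     smooth2_on U z \<and> smooth2_on U x \<and> smooth2_on U y \<and> smooth2_on U n1 \<and> smooth2_on U n2 \<and>
     (\<forall>p\<in>U.
        pd_u z p = f p *\<^sub>R x p \<and>
        pd_u x p = a p *\<^sub>R x p + l1 p *\<^sub>R n1 p + m1 p *\<^sub>R n2 p \<and>
        pd_u y p = - a p *\<^sub>R y p - k p *\<^sub>R n1 p \<and>
        pd_u n1 p = - k p *\<^sub>R x p + l1 p *\<^sub>R y p + b1 p *\<^sub>R n2 p \<and>
        pd_u n2 p = m1 p *\<^sub>R y p - b1 p *\<^sub>R n1 p \<and>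
        pd_v z p = f p *\<^sub>R y p \<and>
        pd_v x p = - c p *\<^sub>R x p - k p *\<^sub>R n1 p \<and>
        pd_v y p = c p *\<^sub>R y p + l2 p *\<^sub>R n1 p + m2 p *\<^sub>R n2 p \<and>
        pd_v n1 p = l2 p *\<^sub>R x p - k p *\<^sub>R y p + b2 p *\<^sub>R n2 p \<and>
        pd_v n2 p = m2 p *\<^sub>R x p - b2 p *\<^sub>R n1 p)"

text \<open>The componentwise form serves the geometry, the single state vector serves
  \<open>linear_frobenius\<close>.\<close>

lemma moving_frame_iff:
  assumes U: "open U"
  shows "moving_frame U z x y n1 n2 \<longleftrightarrow>
    smooth2_on U (\<lambda>p. (z p, x p, y p, n1 p, n2 p)) \<and>
    (\<forall>p\<in>U. pd_u (\<lambda>p. (z p, x p, y p, n1 p, n2 p)) p = coeff_u p (z p, x p, y p, n1 p, n2 p) \<and>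
      pd_v (\<lambda>p. (z p, x p, y p, n1 p, n2 p)) p = coeff_v p (z p, x p, y p, n1 p, n2 p))"
    (is "_ \<longleftrightarrow> smooth2_on U ?X \<and> _")
proof -
  have smooth: "smooth2_on U ?X \<longleftrightarrow>
      smooth2_on U z \<and> smooth2_on U x \<and> smooth2_on U y \<and> smooth2_on U n1 \<and> smooth2_on U n2"
    (is "?L \<longleftrightarrow> ?R")
  proof
    assume X: ?L
    note f = bounded_linear.smooth2_on[OF bounded_linear_fst U] and s = bounded_linear.smooth2_on[OF bounded_linear_snd U]
    from f[OF X] f[OF s[OF X]] f[OF s[OF s[OF X]]] f[OF s[OF s[OF s[OF X]]]] s[OF s[OF s[OF s[OF X]]]]
    show ?R by simp
  qed (simp add: smooth2_on_Pair U)
  moreover have "pd_u ?X p = (pd_u z p, pd_u x p, pd_u y p, pd_u n1 p, pd_u n2 p)"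
    "pd_v ?X p = (pd_v z p, pd_v x p, pd_v y p, pd_v n1 p, pd_v n2 p)"
    if "?R" "p \<in> U" for p
  proof -
    have d: "z differentiable (at p)" "x differentiable (at p)" "y differentiable (at p)"
      "n1 differentiable (at p)" "n2 differentiable (at p)"
      using that smooth2_on_differentiable by blast+
    have p4: "(\<lambda>p. (n1 p, n2 p)) differentiable (at p)"
      using has_derivative_Pair[OF has_derivative_pd[OF d(4)] has_derivative_pd[OF d(5)]]
      by (auto simp: differentiable_def)
    have p3: "(\<lambda>p. (y p, n1 p, n2 p)) differentiable (at p)"
      using has_derivative_Pair[OF has_derivative_pd[OF d(3)] has_derivative_pd[OF p4]]
      by (auto simp: differentiable_def)
    have p2: "(\<lambda>p. (x p, y p, n1 p, n2 p)) differentiable (at p)"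
      using has_derivative_Pair[OF has_derivative_pd[OF d(2)] has_derivative_pd[OF p3]]
      by (auto simp: differentiable_def)
    show "pd_u ?X p = (pd_u z p, pd_u x p, pd_u y p, pd_u n1 p, pd_u n2 p)"
      "pd_v ?X p = (pd_v z p, pd_v x p, pd_v y p, pd_v n1 p, pd_v n2 p)"
      by (simp_all add: pd_Pair d p2 p3 p4)
  qed
  ultimately show ?thesis
    unfolding moving_frame_def coeff_u_def coeff_v_def frame_apply frame_u_def frame_v_def
    by auto
qed

text \<open>The tensor \<open>n1 \<otimes> n1 + n2 \<otimes> n2 - x \<otimes> y - y \<otimes> x\<close> is constant along the system. At q it is the
  inverse of the metric, and being so forces the inner products of the frame vectors.\<close>

lemma moving_frame_mink_frame:
  assumes U: "open U" "convex U" and mf: "moving_frame U z x y n1 n2"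
    and q: "q \<in> U" "mink_frame (x q) (y q) (n1 q) (n2 q)" and p: "p \<in> U"
  shows "mink_frame (x p) (y p) (n1 p) (n2 p)"
proof (rule mink_frameI)
  fix w
  \<comment> \<open>The tensor is evaluated on fixed vectors \<open>w\<close> and \<open>w'\<close>,
    so that only scalar functions are differentiated.\<close>
  define T where "T w' = (\<lambda>p. mink (n1 p) w * mink (n1 p) w' + mink (n2 p) w * mink (n2 p) w'
      + - (mink (x p) w * mink (y p) w' + mink (y p) w * mink (x p) w'))" for w'
  have T: "T w' p = mink w w'" for w'
  proof -
    have "(T w' has_derivative (\<lambda>h. 0)) (at r within U)" if r: "r \<in> U" for r
    proof -
      have d: "x differentiable (at r)" "y differentiable (at r)"
        "n1 differentiable (at r)" "n2 differentiable (at r)"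
        using mf r smooth2_on_differentiable unfolding moving_frame_def by blast+
      have dm: "(\<lambda>p. mink (g p) v) differentiable (at r)" if "g differentiable (at r)" for g v
        using bounded_linear.has_derivative[OF mink.bounded_linear_left has_derivative_pd[OF that]]
        by (auto simp: differentiable_def)
      note pm = bounded_linear.pd[OF mink.bounded_linear_left]
      have dT: "T w' differentiable (at r)"
        unfolding T_def by (intro derivative_intros dm d)
      have "pd_u (T w') r = mink (n1 r) w * mink (pd_u n1 r) w' + mink (pd_u n1 r) w * mink (n1 r) w'
          + (mink (n2 r) w * mink (pd_u n2 r) w' + mink (pd_u n2 r) w * mink (n2 r) w')
          + - (mink (x r) w * mink (pd_u y r) w' + mink (pd_u x r) w * mink (y r) w'
            + (mink (y r) w * mink (pd_u x r) w' + mink (pd_u y r) w * mink (x r) w'))"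
        "pd_v (T w') r = mink (n1 r) w * mink (pd_v n1 r) w' + mink (pd_v n1 r) w * mink (n1 r) w'
          + (mink (n2 r) w * mink (pd_v n2 r) w' + mink (pd_v n2 r) w * mink (n2 r) w')
          + - (mink (x r) w * mink (pd_v y r) w' + mink (pd_v x r) w * mink (y r) w'
            + (mink (y r) w * mink (pd_v x r) w' + mink (pd_v y r) w * mink (x r) w'))"
        unfolding T_def
        by (simp_all only: pd_add pd_mult pd_uminus pm d dm differentiable_add differentiable_mult
            differentiable_minus)
      moreover note mf[unfolded moving_frame_def, THEN conjunct2, THEN conjunct2, THEN conjunct2,
          THEN conjunct2, THEN conjunct2, THEN bspec, OF r]
      ultimately have "pd_u (T w') r = 0" "pd_v (T w') r = 0"
        by (simp_all add: mink_linear) (simp_all add: algebra_simps)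
      then show ?thesis
        using has_derivative_pd[OF dT] by (simp add: has_derivative_at_withinI)
    qed
    then have "T w' p = T w' q"
      using has_derivative_zero_constant[OF U(2)] p q(1) by metis
    also have "T w' q = mink w w'"
    proof -
      note e = mink_frame_expand[OF q(2), of w]
      have "mink w w' = mink (- mink w (y q) *\<^sub>R x q - mink w (x q) *\<^sub>R y q
          + mink w (n1 q) *\<^sub>R n1 q + mink w (n2 q) *\<^sub>R n2 q) w'"
        using e by simp
      then show ?thesis
        by (simp add: T_def mink_linear mink_commute[of w] algebra_simps)
    qed
    finally show ?thesis .
  qed
  \<comment> \<open>The frame expansion of \<open>w\<close> at \<open>p\<close> differs from
    \<open>w\<close> by a vector orthogonal to every \<open>w'\<close>, hence by 0.\<close>
  have "mink (- mink w (y p) *\<^sub>R x p - mink w (x p) *\<^sub>R y p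
      + mink w (n1 p) *\<^sub>R n1 p + mink w (n2 p) *\<^sub>R n2 p - w) w' = 0" for w'
    using T[of w'] by (simp add: T_def mink_linear mink_commute[of w "x p"] mink_commute[of w "y p"]
        mink_commute[of w "n1 p"] mink_commute[of w "n2 p"] algebra_simps)
  from mink_nondegenerate[OF this]
  show "w = - mink w (y p) *\<^sub>R x p - mink w (x p) *\<^sub>R y p + mink w (n1 p) *\<^sub>R n1 p + mink w (n2 p) *\<^sub>R n2 p"
    by simp
qed

text \<open>The normal parts of the second derivatives of \<open>z\<close> are \<open>f\<close>
  times those of the derivatives of \<open>x\<close> and \<open>y\<close>. The latter carry one more
  factor \<open>f\<close>, in \<open>l1\<close>, \<open>m1\<close>, \<open>k\<close>,
  \<open>l2\<close> and \<open>m2\<close>, so division by \<open>f^2\<close> returns the prescribed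
  functions.\<close>

lemma moving_frame_surface:
  assumes U: "domain2 U" "U \<subseteq> D" and mf: "moving_frame U z x y n1 n2"
    and frame: "\<And>p. p \<in> U \<Longrightarrow> mink_frame (x p) (y p) (n1 p) (n2 p)"
  shows "first_type_surface U f z" "geometric_frame_field U f z x y n1 n2"
    "geometric_functions U z x y n1 n2 \<nu> lam1 \<mu>1 lam2 \<mu>2"
proof -
  have oU: "open U" using U by (simp add: domain2_def)
  have pt: "isotropic_point z p (f p) (x p) (y p) (n1 p) (n2 p)" if "p \<in> U" for p
    using that mf f_pos[OF subsetD[OF U(2) that]] frame[OF that]
    by unfold_locales (auto simp: moving_frame_def)
  have main: "second_fundamental z p (x p) (x p) = lam1 p *\<^sub>R n1 p + \<mu>1 p *\<^sub>R n2 p \<and>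
    second_fundamental z p (x p) (y p) = - (\<nu> p *\<^sub>R n1 p) \<and>
    second_fundamental z p (y p) (y p) = lam2 p *\<^sub>R n1 p + \<mu>2 p *\<^sub>R n2 p \<and>
    mean_curvature_vector z p = \<nu> p *\<^sub>R n1 p \<and> mean_curvature z p = \<nu> p"
    if p: "p \<in> U" for p
  proof -
    interpret isotropic_point z p "f p" "x p" "y p" "n1 p" "n2 p" by (rule pt[OF p])
    have pD: "p \<in> D" using p U by blast
    have d: "x differentiable (at p)" "y differentiable (at p)"
      using mf p smooth2_on_differentiable unfolding moving_frame_def by blast+
    have dz: "(\<lambda>q. f q *\<^sub>R x q) differentiable (at p)" "(\<lambda>q. f q *\<^sub>R y q) differentiable (at p)"
      by (intro derivative_intros d diff[OF pD])+
    have zz: "\<And>q. q \<in> U \<Longrightarrow> pd_u z q = f q *\<^sub>R x q" "\<And>q. q \<in> U \<Longrightarrow> pd_v z q = f q *\<^sub>R y q"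
      using mf by (auto simp: moving_frame_def)
    have z2: "pd_u (pd_u z) p = f p *\<^sub>R pd_u x p + pd_u f p *\<^sub>R x p"
      "pd_v (pd_u z) p = f p *\<^sub>R pd_v x p + pd_v f p *\<^sub>R x p"
      "pd_u (pd_v z) p = f p *\<^sub>R pd_u y p + pd_u f p *\<^sub>R y p"
      "pd_v (pd_v z) p = f p *\<^sub>R pd_v y p + pd_v f p *\<^sub>R y p"
      using pd_cong[OF oU p zz(1) dz(1)] pd_cong[OF oU p zz(2) dz(2)]
        pd_scaleR[OF diff(1)[OF pD] d(1)] pd_scaleR[OF diff(1)[OF pD] d(2)] by simp_all
    note fc = compatibility(1,2)[OF pD]
    have xy: "pd_u x p = a p *\<^sub>R x p + l1 p *\<^sub>R n1 p + m1 p *\<^sub>R n2 p"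
        "pd_u y p = - a p *\<^sub>R y p - k p *\<^sub>R n1 p"
        "pd_v x p = - c p *\<^sub>R x p - k p *\<^sub>R n1 p"
        "pd_v y p = c p *\<^sub>R y p + l2 p *\<^sub>R n1 p + m2 p *\<^sub>R n2 p"
      using mf p by (auto simp: moving_frame_def)
    have sff: "second_fundamental z p (x p) (x p) = lam1 p *\<^sub>R n1 p + \<mu>1 p *\<^sub>R n2 p"
      "second_fundamental z p (x p) (y p) = - (\<nu> p *\<^sub>R n1 p)"
      "second_fundamental z p (y p) (y p) = lam2 p *\<^sub>R n1 p + \<mu>2 p *\<^sub>R n2 p"
      unfolding second_fundamental_frame normal_part_eq z2 xy
      using F by (simp_all add: mink_linear fr l1_def l2_def m1_def m2_def k_def power2_eq_square)
    \<comment> \<open>By the frame equations both orders of differentiation give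
      \<open>- (f p * k p)\<close> times \<open>n1 p\<close>.\<close>
    have "pd_v (pd_u z) p = pd_u (pd_v z) p"
      unfolding z2 xy fc by (simp add: algebra_simps)
    from mean_curvature_vector_eq[OF this] have H: "mean_curvature_vector z p = \<nu> p *\<^sub>R n1 p"
      by (simp add: sff)
    \<comment> \<open>Positivity of \<nu> enters here: the length is the square root of
      \<open>\<nu>^2\<close>.\<close>
    have "mean_curvature z p = \<nu> p"
      using nu_pos[OF pD] by (simp add: mean_curvature_def H mink_linear fr real_sqrt_mult)
    with sff H show ?thesis by simp
  qed
  show gff: "geometric_frame_field U f z x y n1 n2"
    unfolding geometric_frame_field_def
  proof (intro conjI ballI)
    fix p assume p: "p \<in> U"
    interpret isotropic_point z p "f p" "x p" "y p" "n1 p" "n2 p" by (rule pt[OF p])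
    show "x p = (1 / f p) *\<^sub>R pd_u z p" "y p = (1 / f p) *\<^sub>R pd_v z p"
      using F by (simp_all add: pd_z)
    show "n1 p \<in> normal_plane z p" "n2 p \<in> normal_plane z p"
      "mink (n1 p) (n1 p) = 1" "mink (n2 p) (n2 p) = 1" "mink (n1 p) (n2 p) = 0"
      by (simp_all add: normal_plane_iff fr)
    show "mean_curvature_vector z p = mean_curvature z p *\<^sub>R n1 p"
      using main[OF p] by simp
  qed (use mf in \<open>simp_all add: moving_frame_def\<close>)
  show gf: "geometric_functions U z x y n1 n2 \<nu> lam1 \<mu>1 lam2 \<mu>2"
    unfolding geometric_functions_def using main by simp
  have "free_of_minimal_points U z"
    unfolding free_of_minimal_points_def
  proof (intro ballI notI)
    fix p assume p: "p \<in> U" and "mean_curvature_vector z p = 0"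
    then have "\<nu> p *\<^sub>R n1 p = 0" using main by metis
    moreover have "n1 p \<noteq> 0" using mink_frameD(5)[OF frame[OF p]] by (auto simp: mink_linear)
    ultimately show False using nu_pos[of p] U(2) p by auto
  qed
  moreover have "timelike_surface U z"
    using mf isotropic_point.immersed[OF pt] isotropic_point.timelike[OF pt] U(1)
    by (simp add: timelike_surface_def immersed_surface_def moving_frame_def)
  moreover have "isotropic_parameters U f z"
    using isotropic_point.isotropic[OF pt] f_pos U(2) by (auto simp: isotropic_parameters_def)
  moreover have "\<forall>p\<in>U. \<mu>1 p \<noteq> 0 \<and> \<mu>2 p \<noteq> 0"
    using mu_nonzero U(2) by blast
  ultimately show "first_type_surface U f z"
    unfolding first_type_surface_def using gff gf by blast
qed

text \<open>This is what uniqueness rests on. The prescribed functions fix the normal parts of the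
  second derivatives of \<open>z\<close>, constancy of the frame products fixes the other
  coordinates up to the normal connection, and the Codazzi equations fix that.\<close>

lemma surface_moving_frame:
  assumes U: "U \<subseteq> D" and surf: "timelike_surface U z" and iso: "isotropic_parameters U f z"
    and gff: "geometric_frame_field U f z x y n1 n2"
    and gf: "geometric_functions U z x y n1 n2 \<nu> lam1 \<mu>1 lam2 \<mu>2"
  shows "moving_frame U z x y n1 n2"
proof -
  have oU: "open U" and sz: "smooth2_on U z"
    using surf by (auto simp: timelike_surface_def immersed_surface_def domain2_def)
  have sf: "smooth2_on U f" using smooth(1) U by (rule smooth2_on_subset)
  have fnz: "f p > 0" if "p \<in> U" for p using f_pos that U by blast
  have sn: "smooth2_on U n1" "smooth2_on U n2"
    using gff by (auto simp: geometric_frame_field_def)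
  have sx: "smooth2_on U x" and sy: "smooth2_on U y"
  proof -
    have sinv: "smooth2_on U (\<lambda>p. 1 / f p)"
      using fnz by (intro smooth2_on_divide oU smooth2_on_const sf) fastforce
    have sm: "smooth2_on U (\<lambda>p. (1 / f p) *\<^sub>R pd_u z p)" "smooth2_on U (\<lambda>p. (1 / f p) *\<^sub>R pd_v z p)"
      by (intro smooth2_on_scaleR oU sinv smooth2_on_pd[OF oU sz])+
    have eq: "\<And>p. p \<in> U \<Longrightarrow> x p = (1 / f p) *\<^sub>R pd_u z p" "\<And>p. p \<in> U \<Longrightarrow> y p = (1 / f p) *\<^sub>R pd_v z p"
      using gff by (auto simp: geometric_frame_field_def)
    show "smooth2_on U x" using smooth2_on_cong[OF oU eq(1)] sm(1) by simp
    show "smooth2_on U y" using smooth2_on_cong[OF oU eq(2)] sm(2) by simp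
  qed
  have z1: "\<And>p. p \<in> U \<Longrightarrow> pd_u z p = f p *\<^sub>R x p" "\<And>p. p \<in> U \<Longrightarrow> pd_v z p = f p *\<^sub>R y p"
    using gff fnz by (force simp: geometric_frame_field_def)+
  have frame_on: "mink_frame (x p) (y p) (n1 p) (n2 p)" if p: "p \<in> U" for p
  proof -
    have "mink (f p *\<^sub>R x p) (f p *\<^sub>R x p) = 0" "mink (f p *\<^sub>R y p) (f p *\<^sub>R y p) = 0"
      "mink (f p *\<^sub>R x p) (f p *\<^sub>R y p) = - (f p)\<^sup>2"
      using iso p z1[OF p] by (auto simp: isotropic_parameters_def)
    then have "mink (x p) (x p) = 0" "mink (y p) (y p) = 0" "(f p)\<^sup>2 * (mink (x p) (y p) + 1) = 0"
      using fnz[OF p] by (auto simp: mink_linear power2_eq_square algebra_simps)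
    then have "mink (x p) (x p) = 0" "mink (y p) (y p) = 0" "mink (x p) (y p) = - 1"
      using fnz[OF p] by simp_all
    moreover have "mink n (x p) = 0 \<and> mink n (y p) = 0" if "n \<in> normal_plane z p" for n
    proof -
      have "pd_u z p \<in> tangent_plane z p" "pd_v z p \<in> tangent_plane z p"
        by (auto simp: tangent_plane_def intro: span_base)
      with that have "mink n (f p *\<^sub>R x p) = 0" "mink n (f p *\<^sub>R y p) = 0"
        using z1[OF p] by (auto simp: normal_plane_def)
      then show ?thesis using fnz[OF p] by (simp add: mink_linear)
    qed
    ultimately show ?thesis
      using gff p by (auto simp: mink_frame_def geometric_frame_field_def mink_commute)
  qed
  have pt: "isotropic_point z p (f p) (x p) (y p) (n1 p) (n2 p)" if "p \<in> U" for p
    using that z1 fnz frame_on by unfold_locales auto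
  note sm = sx sy sn
  \<comment> \<open>The normal connection of the given surface: the only coordinates of the
    derivatives of the frame that are not read off directly from the data.\<close>
  define \<beta>1 where "\<beta>1 = (\<lambda>p. mink (pd_u n1 p) (n2 p))"
  define \<beta>2 where "\<beta>2 = (\<lambda>p. mink (pd_v n1 p) (n2 p))"
  have eqs: "pd_u x p = a p *\<^sub>R x p + l1 p *\<^sub>R n1 p + m1 p *\<^sub>R n2 p \<and>
      pd_u y p = - a p *\<^sub>R y p - k p *\<^sub>R n1 p \<and>
      pd_u n1 p = - k p *\<^sub>R x p + l1 p *\<^sub>R y p + \<beta>1 p *\<^sub>R n2 p \<and>
      pd_u n2 p = m1 p *\<^sub>R y p - \<beta>1 p *\<^sub>R n1 p \<and>
      pd_v x p = - c p *\<^sub>R x p - k p *\<^sub>R n1 p \<and>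
      pd_v y p = c p *\<^sub>R y p + l2 p *\<^sub>R n1 p + m2 p *\<^sub>R n2 p \<and>
      pd_v n1 p = l2 p *\<^sub>R x p - k p *\<^sub>R y p + \<beta>2 p *\<^sub>R n2 p \<and>
      pd_v n2 p = m2 p *\<^sub>R x p - \<beta>2 p *\<^sub>R n1 p" if p: "p \<in> U" for p
  proof -
    interpret isotropic_point z p "f p" "x p" "y p" "n1 p" "n2 p" by (rule pt[OF p])
    have pD: "p \<in> D" using p U by blast
    note fc = compatibility(1,2)[OF pD]
    have d: "x differentiable (at p)" "y differentiable (at p)" "f differentiable (at p)"
      using sm p smooth2_on_differentiable diff(1)[OF pD] by blast+
    have dz: "(\<lambda>q. f q *\<^sub>R x q) differentiable (at p)" "(\<lambda>q. f q *\<^sub>R y q) differentiable (at p)"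
      by (intro derivative_intros d)+
    have z2: "pd_u (pd_u z) p = f p *\<^sub>R (pd_u x p + a p *\<^sub>R x p)"
      "pd_v (pd_u z) p = f p *\<^sub>R (pd_v x p + c p *\<^sub>R x p)"
      "pd_u (pd_v z) p = f p *\<^sub>R (pd_u y p + a p *\<^sub>R y p)"
      "pd_v (pd_v z) p = f p *\<^sub>R (pd_v y p + c p *\<^sub>R y p)"
      using pd_cong[OF oU p z1(1) dz(1)] pd_cong[OF oU p z1(2) dz(2)]
        pd_scaleR[OF d(3,1)] pd_scaleR[OF d(3,2)] fc by (simp_all add: scaleR_add_right)
    \<comment> \<open>Equality of the mixed derivatives of \<open>z\<close>, divided by
      \<open>f\<close>. Pairing it with \<open>x\<close> and \<open>y\<close> yields the tangential
      coordinates, and pairing it with \<open>n1\<close> and \<open>n2\<close> carries the normal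
      part of \<open>pd_u y\<close> over to \<open>pd_v x\<close>.\<close>
    have sym: "pd_u y p + a p *\<^sub>R y p = pd_v x p + c p *\<^sub>R x p"
      using pd_commute[OF oU sz p] F unfolding z2 by simp
    have frq: "\<And>q. q \<in> U \<Longrightarrow> mink (x q) (x q) = 0" "\<And>q. q \<in> U \<Longrightarrow> mink (y q) (y q) = 0"
      "\<And>q. q \<in> U \<Longrightarrow> mink (x q) (y q) = - 1"
      "\<And>q. q \<in> U \<Longrightarrow> mink (n1 q) (n1 q) = 1" "\<And>q. q \<in> U \<Longrightarrow> mink (n2 q) (n2 q) = 1"
      "\<And>q. q \<in> U \<Longrightarrow> mink (n1 q) (n2 q) = 0"
      "\<And>q. q \<in> U \<Longrightarrow> mink (x q) (n1 q) = 0" "\<And>q. q \<in> U \<Longrightarrow> mink (x q) (n2 q) = 0"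
      "\<And>q. q \<in> U \<Longrightarrow> mink (y q) (n1 q) = 0" "\<And>q. q \<in> U \<Longrightarrow> mink (y q) (n2 q) = 0"
      using mink_frameD[OF frame_on] by simp_all
    have xx: "mink (pd_u x p) (x p) = 0" "mink (pd_v x p) (x p) = 0"
      using pd_mink_const[OF oU p sx sx frq(1)] mink_commute[of "x p"] by auto
    have yy: "mink (pd_u y p) (y p) = 0" "mink (pd_v y p) (y p) = 0"
      using pd_mink_const[OF oU p sy sy frq(2)] mink_commute[of "y p"] by auto
    have nn1: "mink (pd_u n1 p) (n1 p) = 0" "mink (pd_v n1 p) (n1 p) = 0"
      using pd_mink_const[OF oU p sn(1) sn(1) frq(4)] mink_commute[of "n1 p"] by auto
    have nn2: "mink (pd_u n2 p) (n2 p) = 0" "mink (pd_v n2 p) (n2 p) = 0"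
      using pd_mink_const[OF oU p sn(2) sn(2) frq(5)] mink_commute[of "n2 p"] by auto
    have n12: "mink (pd_u n2 p) (n1 p) = - \<beta>1 p" "mink (pd_v n2 p) (n1 p) = - \<beta>2 p"
      using pd_mink_const[OF oU p sn(1) sn(2) frq(6)] mink_commute[of "n1 p"] by (auto simp: \<beta>1_def \<beta>2_def)
    have "mink (pd_u y p + a p *\<^sub>R y p) w = mink (pd_v x p + c p *\<^sub>R x p) w" for w
      by (simp only: sym)
    from this[of "x p"] this[of "y p"] have yx: "mink (pd_u y p) (x p) = a p" "mink (pd_v x p) (y p) = c p"
      by (simp_all add: mink_linear fr xx yy)
    have xy: "mink (pd_u x p) (y p) = - a p" "mink (pd_v y p) (x p) = - c p"
      using pd_mink_const[OF oU p sx sy frq(3)] yx mink_commute[of "x p"] by auto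
    have sff: "second_fundamental z p (x p) (x p) = lam1 p *\<^sub>R n1 p + \<mu>1 p *\<^sub>R n2 p"
      "second_fundamental z p (x p) (y p) = - (\<nu> p *\<^sub>R n1 p)"
      "second_fundamental z p (y p) (y p) = lam2 p *\<^sub>R n1 p + \<mu>2 p *\<^sub>R n2 p"
      using gf p by (auto simp: geometric_functions_def)
    have n_coords: "s1 = s2 \<and> t1 = t2"
      if "s1 *\<^sub>R n1 p + t1 *\<^sub>R n2 p = s2 *\<^sub>R n1 p + t2 *\<^sub>R n2 p" for s1 t1 s2 t2
      using arg_cong[OF that, of "\<lambda>w. mink w (n1 p)"] arg_cong[OF that, of "\<lambda>w. mink w (n2 p)"]
      by (simp add: mink_linear fr)
    have xn: "mink (pd_u x p) (n1 p) = l1 p" "mink (pd_u x p) (n2 p) = m1 p"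
      using n_coords[OF sff(1)[unfolded second_fundamental_frame normal_part_eq z2]] F
      by (auto simp: mink_linear fr l1_def m1_def power2_eq_square field_simps)
    have yn: "mink (pd_v y p) (n1 p) = l2 p" "mink (pd_v y p) (n2 p) = m2 p"
      using n_coords[OF sff(3)[unfolded second_fundamental_frame normal_part_eq z2]] F
      by (auto simp: mink_linear fr l2_def m2_def power2_eq_square field_simps)
    have yun: "mink (pd_u y p) (n1 p) = - k p" "mink (pd_u y p) (n2 p) = 0"
    proof -
      have "mink ((1 / (f p)\<^sup>2) *\<^sub>R pd_u (pd_v z) p) (n1 p) *\<^sub>R n1 p
          + mink ((1 / (f p)\<^sup>2) *\<^sub>R pd_u (pd_v z) p) (n2 p) *\<^sub>R n2 p = - \<nu> p *\<^sub>R n1 p + 0 *\<^sub>R n2 p"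
        using sff(2) unfolding second_fundamental_frame normal_part_eq by simp
      from n_coords[OF this[unfolded z2]] show "mink (pd_u y p) (n1 p) = - k p" "mink (pd_u y p) (n2 p) = 0"
        using F by (auto simp: mink_linear fr k_def power2_eq_square field_simps)
    qed
    have "mink (pd_v x p + c p *\<^sub>R x p) w = mink (pd_u y p + a p *\<^sub>R y p) w" for w
      by (simp only: sym)
    from this[of "n1 p"] this[of "n2 p"]
    have xvn: "mink (pd_v x p) (n1 p) = - k p" "mink (pd_v x p) (n2 p) = 0"
      by (simp_all add: mink_linear fr yun)
    have n1x: "mink (pd_u n1 p) (x p) = - l1 p" "mink (pd_v n1 p) (x p) = k p"
      using pd_mink_const[OF oU p sx sn(1) frq(7)] xn xvn mink_commute[of "x p"] by auto
    have n1y: "mink (pd_u n1 p) (y p) = k p" "mink (pd_v n1 p) (y p) = - l2 p"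
      using pd_mink_const[OF oU p sy sn(1) frq(9)] yn yun mink_commute[of "y p"] by auto
    have n2x: "mink (pd_u n2 p) (x p) = - m1 p" "mink (pd_v n2 p) (x p) = 0"
      using pd_mink_const[OF oU p sx sn(2) frq(8)] xn xvn mink_commute[of "x p"] by auto
    have n2y: "mink (pd_u n2 p) (y p) = 0" "mink (pd_v n2 p) (y p) = - m2 p"
      using pd_mink_const[OF oU p sy sn(2) frq(10)] yn yun mink_commute[of "y p"] by auto
    note e = mink_frame_expand[OF frame]
    show ?thesis
      using e[of "pd_u x p"] e[of "pd_u y p"] e[of "pd_u n1 p"] e[of "pd_u n2 p"]
        e[of "pd_v x p"] e[of "pd_v y p"] e[of "pd_v n1 p"] e[of "pd_v n2 p"]
      by (simp add: xx yy nn1 nn2 n12 yx xy xn yn yun xvn n1x n1y n2x n2y) (simp add: \<beta>1_def \<beta>2_def)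
  qed
  \<comment> \<open>Comparing \<open>n1\<close>-components of the mixed derivatives of
    \<open>x\<close> gives \<open>m1 * \<beta>2 = m1 * b2\<close>, and those of \<open>y\<close>
    give \<open>m2 * \<beta>1 = m2 * b1\<close>. Since \<open>\<mu>1\<close>, \<open>\<mu>2\<close>
    and \<open>f\<close> do not vanish, the factors cancel.\<close>
  have "\<beta>1 p = b1 p \<and> \<beta>2 p = b2 p" if p: "p \<in> U" for p
  proof -
    have pD: "p \<in> D" using p U by blast
    note fr = mink_frameD[OF frame_on[OF p]]
    note d = diff[OF pD]
    have dv: "x differentiable (at p)" "y differentiable (at p)" "n1 differentiable (at p)" "n2 differentiable (at p)"
      using sm p smooth2_on_differentiable by blast+
    have ds: "(\<lambda>q. g q *\<^sub>R w q) differentiable (at p)" if "g differentiable (at p)" "w differentiable (at p)"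
      for g and w :: surface
      using that by (intro derivative_intros)
    have dm: "(\<lambda>q. - g q) differentiable (at p)" if "g differentiable (at p)" for g :: "real \<times> real \<Rightarrow> real"
      using that by (intro derivative_intros)
    have dd: "(\<lambda>q. g q + w q) differentiable (at p)" if "g differentiable (at p)" "w differentiable (at p)"
      for g w :: surface
      using that by (intro derivative_intros)
    have xu: "pd_v (pd_u x) p = pd_v (\<lambda>q. a q *\<^sub>R x q + (l1 q *\<^sub>R n1 q + m1 q *\<^sub>R n2 q)) p"
      by (rule pd_cong(2)[OF oU p]) (use eqs in simp, intro dd ds d dv)
    have xv: "pd_u (pd_v x) p = pd_u (\<lambda>q. (- c q) *\<^sub>R x q + (- k q) *\<^sub>R n1 q) p"
      by (rule pd_cong(1)[OF oU p]) (use eqs in simp, intro dd ds dm d dv)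
    have yu: "pd_v (pd_u y) p = pd_v (\<lambda>q. (- a q) *\<^sub>R y q + (- k q) *\<^sub>R n1 q) p"
      by (rule pd_cong(2)[OF oU p]) (use eqs in simp, intro dd ds dm d dv)
    have yv: "pd_u (pd_v y) p = pd_u (\<lambda>q. c q *\<^sub>R y q + (l2 q *\<^sub>R n1 q + m2 q *\<^sub>R n2 q)) p"
      by (rule pd_cong(1)[OF oU p]) (use eqs in simp, intro dd ds d dv)
    have codazzi: "pd_v (pd_u x) p = a p *\<^sub>R pd_v x p + pd_v a p *\<^sub>R x p
        + (l1 p *\<^sub>R pd_v n1 p + pd_v l1 p *\<^sub>R n1 p + (m1 p *\<^sub>R pd_v n2 p + pd_v m1 p *\<^sub>R n2 p))"
      "pd_u (pd_v x) p = (- c p) *\<^sub>R pd_u x p + (- pd_u c p) *\<^sub>R x p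
        + ((- k p) *\<^sub>R pd_u n1 p + (- pd_u k p) *\<^sub>R n1 p)"
      "pd_v (pd_u y) p = (- a p) *\<^sub>R pd_v y p + (- pd_v a p) *\<^sub>R y p
        + ((- k p) *\<^sub>R pd_v n1 p + (- pd_v k p) *\<^sub>R n1 p)"
      "pd_u (pd_v y) p = c p *\<^sub>R pd_u y p + pd_u c p *\<^sub>R y p
        + (l2 p *\<^sub>R pd_u n1 p + pd_u l2 p *\<^sub>R n1 p + (m2 p *\<^sub>R pd_u n2 p + pd_u m2 p *\<^sub>R n2 p))"
      unfolding xu xv yu yv by (simp_all only: pd_add pd_scaleR pd_uminus dd ds dm d dv)
    have "mink (pd_u (pd_v x) p) (n1 p) = mink (pd_v (pd_u x) p) (n1 p)"
      by (simp only: pd_commute[OF oU sx p])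
    then have "m1 p * \<beta>2 p = pd_v l1 p - a p * k p + c p * l1 p + pd_u k p"
      unfolding codazzi by (simp add: eqs[OF p] mink_linear fr algebra_simps)
    then have "m1 p * \<beta>2 p = m1 p * b2 p" unfolding compatibility(4)[OF pD] by simp
    moreover have "mink (pd_u (pd_v y) p) (n1 p) = mink (pd_v (pd_u y) p) (n1 p)"
      by (simp only: pd_commute[OF oU sy p])
    then have "m2 p * \<beta>1 p = pd_u l2 p - c p * k p + a p * l2 p + pd_v k p"
      unfolding codazzi by (simp add: eqs[OF p] mink_linear fr algebra_simps)
    then have "m2 p * \<beta>1 p = m2 p * b1 p" unfolding compatibility(6)[OF pD] by simp
    ultimately show ?thesis
      using mu_nonzero[OF pD] by (simp add: m1_def m2_def)
  qed
  with eqs z1 sz sm show ?thesis by (simp add: moving_frame_def)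
qed

end

section \<open>Existence and uniqueness of the surface\<close>

theorem theorem3p2:
  fixes D :: "(real \<times> real) set"
    and f \<nu> lam1 \<mu>1 lam2 \<mu>2 :: "real \<times> real \<Rightarrow> real"
    and q0 :: "real \<times> real"
    and p0 x0 y0 n10 n20 :: "real ^ 4"
  assumes D: "domain2 D"
    and smooth: "smooth2_on D f" "smooth2_on D \<nu>" "smooth2_on D lam1" "smooth2_on D \<mu>1"
      "smooth2_on D lam2" "smooth2_on D \<mu>2"
    and f_pos: "\<And>p. p \<in> D \<Longrightarrow> f p > 0"
    and nu_pos: "\<And>p. p \<in> D \<Longrightarrow> \<nu> p > 0"
    and mu_nz: "\<And>p. p \<in> D \<Longrightarrow> \<mu>1 p * \<mu>2 p \<noteq> 0"
    and i: "\<And>p. p \<in> D \<Longrightarrow>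
      pd_u (\<lambda>q. (lam2 q)\<^sup>2 + (\<mu>2 q)\<^sup>2) p
      + pd_u (\<lambda>q. ln (f q ^ 4)) p * ((lam2 p)\<^sup>2 + (\<mu>2 p)\<^sup>2)
      + 2 * lam2 p * pd_v \<nu> p
      + 2 * \<nu> p * \<mu>2 p / \<mu>1 p * (pd_u \<nu> p + pd_v lam1 p + lam1 p * pd_v (\<lambda>q. ln ((f q)\<^sup>2)) p) = 0"
    and ii: "\<And>p. p \<in> D \<Longrightarrow>
      pd_v (\<lambda>q. (lam1 q)\<^sup>2 + (\<mu>1 q)\<^sup>2) p
      + pd_v (\<lambda>q. ln (f q ^ 4)) p * ((lam1 p)\<^sup>2 + (\<mu>1 p)\<^sup>2)
      + 2 * lam1 p * pd_u \<nu> p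
      + 2 * \<nu> p * \<mu>1 p / \<mu>2 p * (pd_u lam2 p + pd_v \<nu> p + lam2 p * pd_u (\<lambda>q. ln ((f q)\<^sup>2)) p) = 0"
    and iii: "\<And>p. p \<in> D \<Longrightarrow>
      (2 * f p * pd_v (pd_u f) p - 2 * pd_u f p * pd_v f p) / f p ^ 4
      + lam1 p * lam2 p + \<mu>1 p * \<mu>2 p - (\<nu> p)\<^sup>2 = 0"
    and iv: "\<And>p. p \<in> D \<Longrightarrow>
      (\<mu>1 p * lam2 p - \<mu>2 p * lam1 p)
        * ((f p)\<^sup>2 * \<mu>1 p * \<mu>2 p - pd_v (pd_u (\<lambda>q. ln ((f q)\<^sup>2))) p)
      + pd_u (pd_u \<nu>) p * \<mu>2 p - pd_v (pd_v \<nu>) p * \<mu>1 p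
      + pd_v (pd_u lam1) p * \<mu>2 p - pd_v (pd_u lam2) p * \<mu>1 p
      + \<mu>2 p * pd_u lam1 p * pd_v (\<lambda>q. ln ((f q)\<^sup>2)) p
      - \<mu>1 p * pd_v lam2 p * pd_u (\<lambda>q. ln ((f q)\<^sup>2)) p
      - \<mu>2 p * pd_u \<mu>1 p / \<mu>1 p
        * (pd_u \<nu> p + pd_v lam1 p + lam1 p * pd_v (\<lambda>q. ln ((f q)\<^sup>2)) p)
      + \<mu>1 p * pd_v \<mu>2 p / \<mu>2 p
        * (pd_u lam2 p + pd_v \<nu> p + lam2 p * pd_u (\<lambda>q. ln ((f q)\<^sup>2)) p) = 0"
    and frame0: "pseudo_orthonormal_frame x0 y0 n10 n20"
    and q0: "q0 \<in> D"
  shows "\<exists>D0. D0 \<subseteq> D \<and> domain2 D0 \<and> q0 \<in> D0 \<and>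
    (\<exists>z. first_type_surface D0 f z \<and>
         realizes D0 f \<nu> lam1 \<mu>1 lam2 \<mu>2 q0 p0 x0 y0 n10 n20 z \<and>
         (\<forall>z'. first_type_surface D0 f z' \<and>
               realizes D0 f \<nu> lam1 \<mu>1 lam2 \<mu>2 q0 p0 x0 y0 n10 n20 z'
               \<longrightarrow> (\<forall>p\<in>D0. z' p = z p)))"
proof -
  have oD: "open D" using D by (simp add: domain2_def)
  interpret prescribed_functions D f \<nu> lam1 \<mu>1 lam2 \<mu>2
    by (rule prescribed_functions.intro; fact oD smooth f_pos nu_pos mu_nz i ii iii iv)
  \<comment> \<open>\<open>U\<close> is fixed before any surface is considered, so a competing
    surface is compared with \<open>z\<close> on all of \<open>U\<close>. Its convexity gives
    connectedness and lets the vanishing derivative of the frame tensor imply constancy.\<close>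
  obtain U where U: "open U" "convex U" "U \<subseteq> D" "q0 \<in> U"
    and ex: "\<And>w. \<exists>X. X q0 = w \<and> smooth2_on U X \<and> (\<forall>p\<in>U. pd_u X p = coeff_u p (X p) \<and> pd_v X p = coeff_v p (X p))"
    and unique: "\<And>X Y p. smooth2_on U X \<Longrightarrow> smooth2_on U Y \<Longrightarrow> X q0 = Y q0 \<Longrightarrow>
      (\<And>p. p \<in> U \<Longrightarrow> pd_u X p = coeff_u p (X p) \<and> pd_v X p = coeff_v p (X p)) \<Longrightarrow>
      (\<And>p. p \<in> U \<Longrightarrow> pd_u Y p = coeff_u p (Y p) \<and> pd_v Y p = coeff_v p (Y p)) \<Longrightarrow> p \<in> U \<Longrightarrow> X p = Y p"
    using linear_frobenius[OF oD smooth_coeff q0 coeff_compatible] by blast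
  have dom: "domain2 U"
    using U convex_connected by (auto simp: domain2_def)
  obtain X where X: "X q0 = (p0, x0, y0, n10, n20)" "smooth2_on U X"
    "\<forall>p\<in>U. pd_u X p = coeff_u p (X p) \<and> pd_v X p = coeff_v p (X p)"
    using ex by blast
  define z x y n1 n2 where "z = (\<lambda>p. fst (X p))" and "x = (\<lambda>p. fst (snd (X p)))"
    and "y = (\<lambda>p. fst (snd (snd (X p))))" and "n1 = (\<lambda>p. fst (snd (snd (snd (X p)))))"
    and "n2 = (\<lambda>p. snd (snd (snd (snd (X p)))))"
  have X_eq: "X = (\<lambda>p. (z p, x p, y p, n1 p, n2 p))"
    by (simp add: z_def x_def y_def n1_def n2_def)
  have init: "z q0 = p0" "x q0 = x0" "y q0 = y0" "n1 q0 = n10" "n2 q0 = n20"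
    using X(1) by (simp_all add: X_eq)
  have mf: "moving_frame U z x y n1 n2"
    unfolding moving_frame_iff[OF U(1)] X_eq[symmetric] using X by (auto simp: X_eq)
  have frame: "mink_frame (x p) (y p) (n1 p) (n2 p)" if "p \<in> U" for p
    using moving_frame_mink_frame[OF U(1,2) mf U(4) _ that] pseudo_orthonormal_frame_imp_mink_frame[OF frame0]
    by (simp add: init)
  note surf = moving_frame_surface[OF dom U(3) mf frame]
  have "z' p = z p" if z': "first_type_surface U f z'"
    "realizes U f \<nu> lam1 \<mu>1 lam2 \<mu>2 q0 p0 x0 y0 n10 n20 z'" and p: "p \<in> U" for z' p
  proof -
    obtain x' y' n1' n2' where gff: "geometric_frame_field U f z' x' y' n1' n2'"
      and gf: "geometric_functions U z' x' y' n1' n2' \<nu> lam1 \<mu>1 lam2 \<mu>2"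
      and init': "z' q0 = p0" "x' q0 = x0" "y' q0 = y0" "n1' q0 = n10" "n2' q0 = n20"
      using z'(2) unfolding realizes_def by blast
    have "moving_frame U z' x' y' n1' n2'"
      using z'(1) by (intro surface_moving_frame[OF U(3) _ _ gff gf]) (auto simp: first_type_surface_def)
    note mf' = this[unfolded moving_frame_iff[OF U(1)]]
    \<comment> \<open>The frame of \<open>z'\<close> is the one provided by \<open>realizes\<close>.
      Its value at \<open>q0\<close> is prescribed, including the sign of the second normal, so both
      state vectors have the same initial value.\<close>
    have "(z' p, x' p, y' p, n1' p, n2' p) = X p"
      by (rule unique[OF conjunct1[OF mf'] X(2) _ bspec[OF conjunct2[OF mf']] bspec[OF X(3)] p])
        (simp add: X(1) init')
    then show ?thesis by (simp add: X_eq)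
  qed
  moreover have "realizes U f \<nu> lam1 \<mu>1 lam2 \<mu>2 q0 p0 x0 y0 n10 n20 z"
    unfolding realizes_def using surf(2,3) init by blast
  ultimately show ?thesis
    using U(3,4) dom surf(1) by blast
qed

end
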